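(* Let $0<M\le L<\infty$. There exist constants $C_6,C_7,C_8>0$ depending only on $M$ and $L$ such that for every $d\in\mathbb{N}$ and every $\boldsymbol\delta=(\delta_j)_{j=1}^d\in(0,\infty)^d$ the following holds. Let $\rho,\pi$ be probability measures on $[-1,1]^d$ with densities $f_\rho,f_\pi$ with respect to $\mu$, and suppose that for both $*\in\{\rho,\pi\}$: (a) $f_*:[-1,1]^d\to(0,\infty)$ is a probability density and $f_*\in C^1(\mathcal{B}_{\boldsymbol\delta}([-1,1]);\mathbb{C})$; (b) $M\le|f_*(\boldsymbol x)|\le L$ for all $\boldsymbol x\in\mathcal{B}_{\boldsymbol\delta}([-1,1])$; (c) $\sup_{\boldsymbol y\in\mathcal{B}_{\boldsymbol\delta}}|f_*(\boldsymbol x+\boldsymbol y)-f_*(\boldsymbol x)|\le C_6$ for all $\boldsymbol x\in[-1,1]^d$; (d) $\sup_{\boldsymbol y\in\mathcal{B}_{\boldsymbol\delta_{[k]}}\times\{0\}^{d-k}}|f_*(\boldsymbol x+\boldsymbol y)-f_*(\boldsymbol x)|\le C_6\,\delta_{k+1}$ for all $\boldsymbol x\in[-1,1]^d$ and all $k\in\{1,\dots,d-1\}$. Let $T=(T_k)_{k=1}^d$ be the Knothe--Rosenblatt transport from $\rho$ to $\pi$, let $R_k:=\partial_{x_k}T_k$, and let $\boldsymbol\zeta=(\zeta_k)_{k=1}^d$ with $\zeta_k:=C_7\delta_k$. Then for all $k\in\{1,\dots,d\}$: (i) $R_k\in C^1(\mathcal{B}_{\boldsymbol\zeta_{[k]}}([-1,1]);\mathcal{B}_{C_8}(1))$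 and $\Re(R_k(\boldsymbol x))\ge \frac1{C_8}$ for all $\boldsymbol x\in\mathcal{B}_{\boldsymbol\zeta_{[k]}}([-1,1])$; (ii) if $k\ge2$, then $R_k:\mathcal{B}_{\boldsymbol\zeta_{[k-1]}}([-1,1])\times[-1,1]\to\mathcal{B}_{C_8/\max\{1,\delta_k\}}(1)$.
   Context: $\mu$ is the product measure $\bigotimes_{j}\lambda/2$ on $[-1,1]^k$ ($\lambda$ Lebesgue measure on $[-1,1]$; the dimension $k$ is clear from context). "$f:[-1,1]^d\to(0,\infty)$ is a probability density" means $f$ is measurable, positive, and $\int f\,d\mu=1$. For a vector, $\boldsymbol x_{[k]}=(x_1,\dots,x_k)$. For $\delta>0$ and $S\subseteq\mathbb{C}$, $\mathcal{B}_\delta(S)=\{z\in\mathbb{C}:\exists y\in S,\ |z-y|<\delta\}$ (for a point $c$, $\mathcal B_\delta(c)=\mathcal B_\delta(\{c\})$). For $\boldsymbol\delta\in(0,\infty)^d$, $\mathcal{B}_{\boldsymbol\delta}(S)=\prod_{i=1}^d\mathcal{B}_{\delta_i}(S)\subseteq\mathbb{C}^d$, and $\mathcal{B}_{\boldsymbol\delta}=\prod_{i=1}^d\mathcal{B}_{\delta_i}(0)$. For open $O\subseteq\mathbb{C}^n$, $C^1(O;\mathbb{C})$ means complex differentiable (holomorphic) functions, and $C^1(O;B)$ those with values in $B$. For a function given on $[-1,1]^n$, membership in $C^1(\mathcal{B}_{\boldsymbol\delta}([-1,1]);\cdot)$ means that it has a holomorphic extension to that set, denoted by the same symbol. Knothe--Rosenblatt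 transport: let $f_\rho,f_\pi$ be continuous positive densities. For a density $f$ put $\hat f_0:=1$, $\hat f_k(\boldsymbol x_{[k]}):=\int_{[-1,1]^{d-k}}f(\boldsymbol x_{[k]},\boldsymbol t)\,d\mu(\boldsymbol t)$ and $f_k(\boldsymbol x_{[k]}):=\hat f_k(\boldsymbol x_{[k]})/\hat f_{k-1}(\boldsymbol x_{[k-1]})$ for $k=1,\dots,d$; write $f_{\rho;k},f_{\pi;k}$ for these functions when $f=f_\rho,f_\pi$. Put $F_{*;k}(\boldsymbol x_{[k]}):=\int_{-1}^{x_k}f_{*;k}(\boldsymbol x_{[k-1]},t)\,dt$ for $*\in\{\rho,\pi\}$. Then $T_1:=(F_{\pi;1})^{-1}\circ F_{\rho;1}$ and, inductively, $T_k(\boldsymbol x_{[k-1]},\cdot):=F_{\pi;k}(T_1(x_1),\dots,T_{k-1}(\boldsymbol x_{[k-1]}),\cdot)^{-1}\circ F_{\rho;k}(\boldsymbol x_{[k-1]},\cdot)$, where inverses are taken in the last variable. $T=(T_k)_{k=1}^d:[-1,1]^d\to[-1,1]^d$. *)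

theory Defs
  imports "HOL-Probability.Probability"
begin

text \<open>
  Since the constants of the theorem must not depend on the dimension, vectors with \<open>n\<close>
  components are extensional functions on \<open>{1..n}\<close> (elements of some \<open>PiE {1..n} S\<close>) rather than
  elements of a type-indexed \<open>real ^ 'n\<close>.
\<close>

definition cube :: "nat \<Rightarrow> (nat \<Rightarrow> real) set" where
  "cube n = PiE {1..n} (\<lambda>_. {-1..1})"

definition half_lebesgue :: "real measure" where
  "half_lebesgue = density (restrict_space lborel {-1..1}) (\<lambda>_. ennreal (1/2))"

definition cube_measure :: "nat \<Rightarrow> (nat \<Rightarrow> real) measure" where
  "cube_measure n = PiM {1..n} (\<lambda>_. half_lebesgue)"

definition prob_density :: "nat \<Rightarrow> ((nat \<Rightarrow> real) \<Rightarrow> real) \<Rightarrow> bool" where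
  "prob_density d f \<longleftrightarrow>
     f \<in> borel_measurable (cube_measure d) \<and> (\<forall>x\<in>cube d. 0 < f x) \<and>
     has_bochner_integral (cube_measure d) f 1"

subsection \<open>Neighbourhoods\<close>

definition cinterval :: "complex set" where
  "cinterval = complex_of_real ` {-1..1}"

definition nbhd :: "real \<Rightarrow> complex set \<Rightarrow> complex set" where
  "nbhd r S = {z. \<exists>y\<in>S. cmod (z - y) < r}"

definition poly_nbhd :: "nat \<Rightarrow> (nat \<Rightarrow> real) \<Rightarrow> complex set \<Rightarrow> (nat \<Rightarrow> complex) set" where
  "poly_nbhd n \<delta> S = PiE {1..n} (\<lambda>i. nbhd (\<delta> i) S)"

definition embed :: "nat \<Rightarrow> (nat \<Rightarrow> real) \<Rightarrow> nat \<Rightarrow> complex" where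
  "embed n x = (\<lambda>i\<in>{1..n}. complex_of_real (x i))"

subsection \<open>Holomorphy in several variables\<close>

text \<open>
  Complex (Frechet) differentiability at every point of \<open>U\<close>, where \<open>U\<close> is meant to be an open
  subset of \<open>PiE {1..n} (\<lambda>_. UNIV)\<close>; the vector \<open>a\<close> represents the complex-linear derivative.
\<close>

definition holomorphic_nvar ::
    "nat \<Rightarrow> ((nat \<Rightarrow> complex) \<Rightarrow> complex) \<Rightarrow> (nat \<Rightarrow> complex) set \<Rightarrow> bool" where
  "holomorphic_nvar n F U \<longleftrightarrow>
     (\<forall>z\<in>U. \<exists>a :: nat \<Rightarrow> complex. \<forall>\<epsilon>>0. \<exists>\<eta>>0. \<forall>w\<in>U.
        L2_set (\<lambda>i. cmod (w i - z i)) {1..n} < \<eta> \<longrightarrow>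
        cmod (F w - F z - (\<Sum>i\<in>{1..n}. a i * (w i - z i)))
          \<le> \<epsilon> * L2_set (\<lambda>i. cmod (w i - z i)) {1..n})"

definition holomorphic_extension ::
    "nat \<Rightarrow> ((nat \<Rightarrow> real) \<Rightarrow> real) \<Rightarrow> ((nat \<Rightarrow> complex) \<Rightarrow> complex) \<Rightarrow>
      (nat \<Rightarrow> complex) set \<Rightarrow> bool" where
  "holomorphic_extension n f F U \<longleftrightarrow>
     holomorphic_nvar n F U \<and> (\<forall>x\<in>cube n. F (embed n x) = complex_of_real (f x))"

subsection \<open>The Knothe--Rosenblatt transport\<close>

text \<open>
  For \<open>k \<le> d\<close>, the functions \<open>marginal d f k\<close>, \<open>conditional d f k\<close>, \<open>cond_cdf d f k\<close> and
  \<open>KR d f g k\<close> only read the components \<open>x 1, \<dots>, x k\<close> of their vector argument.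
\<close>

definition marginal :: "nat \<Rightarrow> ((nat \<Rightarrow> real) \<Rightarrow> real) \<Rightarrow> nat \<Rightarrow> (nat \<Rightarrow> real) \<Rightarrow> real" where
  "marginal d f k x =
     (if k = 0 then 1
      else (\<integral>t. f (merge {1..k} {k+1..d} (x, t)) \<partial>PiM {k+1..d} (\<lambda>_. half_lebesgue)))"

definition conditional :: "nat \<Rightarrow> ((nat \<Rightarrow> real) \<Rightarrow> real) \<Rightarrow> nat \<Rightarrow> (nat \<Rightarrow> real) \<Rightarrow> real" where
  "conditional d f k x = marginal d f k x / marginal d f (k - 1) x"

text \<open>
  The integral is with respect to Lebesgue measure \<open>dt\<close> rather than \<open>dt / 2\<close>, so that
  \<open>t \<mapsto> cond_cdf d f k (x(k := t))\<close> maps \<open>{-1..1}\<close> onto \<open>{0..2}\<close> for a continuous positive density.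
\<close>

definition cond_cdf :: "nat \<Rightarrow> ((nat \<Rightarrow> real) \<Rightarrow> real) \<Rightarrow> nat \<Rightarrow> (nat \<Rightarrow> real) \<Rightarrow> real" where
  "cond_cdf d f k x = (LBINT t:{-1..x k}. conditional d f k (x(k := t)))"

function KR :: "nat \<Rightarrow> ((nat \<Rightarrow> real) \<Rightarrow> real) \<Rightarrow> ((nat \<Rightarrow> real) \<Rightarrow> real) \<Rightarrow>
    nat \<Rightarrow> (nat \<Rightarrow> real) \<Rightarrow> real" where
  "KR d f g k x =
     inv_into {-1..1} (\<lambda>t. cond_cdf d g k (\<lambda>i. if i < k then KR d f g i x else t))
       (cond_cdf d f k x)"
  by pat_completeness auto
termination by (relation "Wellfounded.measure (\<lambda>(d, f, g, k, x). k)") auto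

declare KR.simps [simp del]

text \<open>
  The partial derivative in the \<open>k\<close>-th variable is taken within \<open>{-1..1}\<close>, hence one-sided on the
  faces \<open>x k = -1\<close> and \<open>x k = 1\<close>.
\<close>

definition KR_deriv :: "nat \<Rightarrow> ((nat \<Rightarrow> real) \<Rightarrow> real) \<Rightarrow> ((nat \<Rightarrow> real) \<Rightarrow> real) \<Rightarrow>
    nat \<Rightarrow> (nat \<Rightarrow> real) \<Rightarrow> real" where
  "KR_deriv d f g k x =
     vector_derivative (\<lambda>t. KR d f g k (x(k := t))) (at (x k) within {-1..1})"

subsection \<open>The assumptions on a density\<close>

text \<open>
  \<open>F\<close> is the holomorphic extension of \<open>f\<close>, which the bounds refer to; it is uniquely determined
  on \<open>poly_nbhd d \<delta> cinterval\<close>. A bound on a supremum is stated as a bound for all elements.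
\<close>

definition admissible_density :: "nat \<Rightarrow> (nat \<Rightarrow> real) \<Rightarrow> real \<Rightarrow> real \<Rightarrow> real \<Rightarrow>
    ((nat \<Rightarrow> real) \<Rightarrow> real) \<Rightarrow> ((nat \<Rightarrow> complex) \<Rightarrow> complex) \<Rightarrow> bool" where
  "admissible_density d \<delta> M L C f F \<longleftrightarrow>
     prob_density d f \<and>
     holomorphic_extension d f F (poly_nbhd d \<delta> cinterval) \<and>
     (\<forall>z\<in>poly_nbhd d \<delta> cinterval. M \<le> cmod (F z) \<and> cmod (F z) \<le> L) \<and>
     (\<forall>x\<in>cube d. \<forall>y\<in>poly_nbhd d \<delta> {0}.
        cmod (F (\<lambda>i\<in>{1..d}. embed d x i + y i) - F (embed d x)) \<le> C) \<and>
     (\<forall>x\<in>cube d. \<forall>k\<in>{1..d-1}. \<forall>y\<in>PiE {1..d} (\<lambda>i. if i \<le> k then nbhd (\<delta> i) {0} else {0}).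
        cmod (F (\<lambda>i\<in>{1..d}. embed d x i + y i) - F (embed d x)) \<le> C * \<delta> (k + 1))"

end

theory Submission
  imports Defs "HOL-Complex_Analysis.Complex_Analysis"
begin

text \<open>
  Put \<open>q = M / L\<close> and let \<open>P k\<close> be the complexified marginals. The smallness assumptions pass from
  the density to \<open>P k\<close>, so the conditionals \<open>P k / P (k - 1)\<close> extend holomorphically, with real part
  at least \<open>q / 2\<close> and modulus at most \<open>2 / q\<close>; with the last variable kept real they even stay
  within \<open>O(q\<^sup>5 \<delta> k)\<close> of real values. Hence the complexified conditional distribution functions are
  bi-Lipschitz in the last variable and close to real ones. A quantitative open mapping argument
  around the real solution then shows that the equation defining \<open>T\<^sub>k\<close> keeps a unique root within
  distance \<open>\<delta> k / 2\<close> of the interval, and this root is holomorphic. Finally \<open>R\<^sub>k\<close> is the quotient of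
  the two conditionals. The bound (ii) holds because each conditional has mean 1 over the interval
  and, by Cauchy's estimate, derivative \<open>O(1 / \<delta> k)\<close> in its last variable.
\<close>

subsection \<open>One complex variable\<close>

text \<open>The constants must not depend on \<open>d\<close>, so nothing may deteriorate along the
  induction on \<open>k\<close>. What saves the radii is that the root for component
  \<open>k\<close> is compared with a real equation whose parameters are arbitrary real points near
  the lower components, not their values under a real transport. It therefore suffices that those
  components lie in the polydisc of radii \<open>\<delta>\<close>, and the new root always returns
  with radius \<open>\<delta> k / 2\<close>, whatever their errors were. The remaining factor 2 is
  room for Cauchy's estimates in (ii).

  Hypothesis (c) alone could not locate the root: it gives an error of fixed size, useless when
  \<open>\<delta> k\<close> is small against it. Hypothesis (d) makes the error of the distribution
  functions a small multiple of \<open>\<delta> k\<close>, the order of the displacement allowed to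
  the root.

  The powers of \<open>q\<close> come from two successive quotients: an error
  \<open>M * q ^ 6 / 512\<close> of the marginals becomes \<open>q ^ 5 / 128\<close> for the
  conditionals and \<open>q ^ 2 / 32\<close> for \<open>R\<close>, which is small against the real
  quotient, at least \<open>q ^ 2\<close>.\<close>

lemma norm_deriv_le_bounded:
  assumes "g holomorphic_on ball a r" "0 < e" "\<And>x. x \<in> ball a r \<Longrightarrow> norm (g x) \<le> B"
    "dist a x + e < r"
  shows "norm ((deriv ^^ n) g x) \<le> fact n * B / e ^ n"
proof (rule Cauchy_inequality)
  have sub: "cball x e \<subseteq> ball a r"
  proof
    fix y assume "y \<in> cball x e"
    then show "y \<in> ball a r" using assms(4) dist_triangle[of a y x] by (auto simp: dist_commute)
  qed
  show "g holomorphic_on ball x e"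
    using assms(1) sub ball_subset_cball holomorphic_on_subset by blast
  show "continuous_on (cball x e) g"
    using assms(1) sub holomorphic_on_imp_continuous_on continuous_on_subset by blast
  show "norm (g y) \<le> B" if "norm (x - y) = e" for y
    using that sub assms(3)[of y] by (auto simp: dist_norm subset_iff)
qed (use assms in auto)

lemma norm_deriv_le:
  fixes g :: "complex \<Rightarrow> complex"
  assumes "g holomorphic_on ball x r" "0 < r" "\<And>y. y \<in> ball x r \<Longrightarrow> norm (g y) \<le> B"
  shows "norm (deriv g x) \<le> 2 * B / r"
  using norm_deriv_le_bounded[of g x r "r/2" B x 1] assms by (simp add: mult.commute)

text \<open>Mean value inequality on the half ball, where Cauchy's estimate with discs of radius
  \<open>r / 2\<close> bounds the derivative.\<close>

lemma norm_diff_le_bounded_holomorphic: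
  fixes g :: "complex \<Rightarrow> complex"
  assumes g: "g holomorphic_on ball a r" "0 < r" "\<And>x. x \<in> ball a r \<Longrightarrow> norm (g x) \<le> B"
    and x: "dist a x \<le> r / 2"
  shows "norm (g x - g a) \<le> 4 * B / r * norm (x - a)"
proof (rule field_differentiable_bound[where S = "cball a (r/2)" and f' = "deriv g"])
  fix z assume z: "z \<in> cball a (r/2)"
  then show "(g has_field_derivative deriv g z) (at z within cball a (r / 2))"
    using g by (auto intro!: holomorphic_derivI[of _ "ball a r"])
  show "norm (deriv g z) \<le> 4 * B / r"
  proof -
    have "ball z (r/2) \<subseteq> ball a r"
      by (metis field_sum_of_halves z mem_cball dist_commute add_mono order_refl ball_subset_ball_iff)
    then have "norm (deriv g z) \<le> 2 * B / (r/2)"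
      using g by (intro norm_deriv_le) (auto intro: holomorphic_on_subset)
    then show ?thesis by simp
  qed
qed (use assms in auto)

text \<open>Taylor's formula of order two. The bound depends on \<open>g\<close> only through
  \<open>B\<close> and \<open>r\<close>, hence is uniform over families of functions with a common
  bound; both the implicit function argument and the passage from curves to Frechet derivatives rest
  on this.\<close>

lemma norm_quadratic_remainder_le:
  fixes g :: "complex \<Rightarrow> complex"
  assumes g: "g holomorphic_on ball a r" "0 < r" "\<And>x. x \<in> ball a r \<Longrightarrow> norm (g x) \<le> B"
    and x: "dist a x \<le> r / 2"
  shows "norm (g x - g a - deriv g a * (x - a)) \<le> 32 * B / r\<^sup>2 * (norm (x - a))\<^sup>2"
proof -
  have d: "norm (deriv (deriv g) z) \<le> 32 * B / r\<^sup>2" if "z \<in> cball a (r/2)" for z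
  proof -
    \<comment> \<open>The half ball leaves distance \<open>r / 2\<close> to the boundary, so discs
      of radius \<open>r / 4\<close> fit; the constant is 2 * 16 = 32.\<close>
    have "norm ((deriv ^^ 2) g z) \<le> fact 2 * B / (r/4)^2"
      using that g by (intro norm_deriv_le_bounded[where a = a and r = r]) auto
    then show ?thesis by (simp add: power_divide numeral_2_eq_2)
  qed
  have "norm ((deriv ^^ 0) g x - (\<Sum>i\<le>1. (deriv ^^ i) g a * (x - a) ^ i / fact i))
     \<le> 32 * B / r\<^sup>2 * norm (x - a) ^ Suc 1 / fact 1"
  proof (rule complex_Taylor[where S = "cball a (r/2)"])
    fix i z assume z: "z \<in> cball a (r/2)"
    then have "(deriv ^^ i) g holomorphic_on ball a r"
      using g by (simp add: holomorphic_higher_deriv)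
    then have "((deriv ^^ i) g has_field_derivative deriv ((deriv ^^ i) g) z) (at z within cball a (r / 2))"
      using z g by (intro holomorphic_derivI[of _ "ball a r"]) auto
    then show "((deriv ^^ i) g has_field_derivative (deriv ^^ Suc i) g z) (at z within cball a (r / 2))"
      by simp
  qed (use d x g in auto)
  then show ?thesis by (simp add: algebra_simps numeral_2_eq_2)
qed

text \<open>Implicit function theorem for a root that is already given. \<open>E\<close> is
  holomorphic in each variable separately, and two uniform estimates replace joint
  differentiability: the expansion \<open>c\<close> makes \<open>S\<close> continuous, and the bound
  \<open>B\<close> makes the difference quotients of \<open>E l\<close> at \<open>s0\<close>
  converge to \<open>e l0 s0\<close> although \<open>l\<close> moves at the same time. The equation
  can then be solved for the difference quotient of \<open>S\<close>.\<close>

lemma holomorphic_implicit: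
  fixes E e :: "complex \<Rightarrow> complex \<Rightarrow> complex"
  assumes W: "open W" and V: "open V" and S: "\<And>l. l \<in> W \<Longrightarrow> S l \<in> V"
    and zero: "\<And>l. l \<in> W \<Longrightarrow> E l (S l) = 0"
    and hol: "\<And>s. s \<in> V \<Longrightarrow> (\<lambda>l. E l s) holomorphic_on W"
    and dE: "\<And>l s. l \<in> W \<Longrightarrow> s \<in> V \<Longrightarrow> (E l has_field_derivative e l s) (at s)"
    and hole: "\<And>s. s \<in> V \<Longrightarrow> (\<lambda>l. e l s) holomorphic_on W"
    and bd: "\<And>l s. l \<in> W \<Longrightarrow> s \<in> V \<Longrightarrow> norm (E l s) \<le> B"
    and c: "0 < c" "\<And>l s s'. l \<in> W \<Longrightarrow> s \<in> V \<Longrightarrow> s' \<in> V \<Longrightarrow> c * norm (s - s') \<le> norm (E l s - E l s')"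
    and nz: "\<And>l s. l \<in> W \<Longrightarrow> s \<in> V \<Longrightarrow> e l s \<noteq> 0"
  shows "S holomorphic_on W"
proof (subst holomorphic_on_open[OF W], safe)
  fix l0 assume l0: "l0 \<in> W"
  define s0 where "s0 = S l0"
  have s0: "s0 \<in> V" by (simp add: s0_def S l0)
  obtain r where r: "r > 0" "ball s0 r \<subseteq> V" using V s0 open_contains_ball by blast
  define K where "K = 32 * B / r\<^sup>2"
  define D where "D = deriv (\<lambda>l. E l s0) l0"
  have dD: "((\<lambda>l. E l s0) has_field_derivative D) (at l0)"
    unfolding D_def using holomorphic_derivI hol[OF s0] W l0 by blast
  have evW: "\<forall>\<^sub>F l in at l0. l \<in> W" using W l0 by (simp add: eventually_at_in_open')
  have Slip: "c * norm (S l - s0) \<le> norm (E l s0)" if "l \<in> W" for l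
    using c(2)[OF that S[OF that] s0] zero[OF that] by simp
  have lim0: "((\<lambda>l. E l s0) \<longlongrightarrow> 0) (at l0)"
    using dD[THEN DERIV_isCont] zero[OF l0] by (simp add: isCont_def s0_def)
  have Slim: "((\<lambda>l. S l - s0) \<longlongrightarrow> 0) (at l0)"
  proof (rule Lim_null_comparison)
    show "\<forall>\<^sub>F l in at l0. norm (S l - s0) \<le> norm (E l s0) / c"
      using evW by eventually_elim (use Slip c(1) in \<open>simp add: field_simps\<close>)
    show "((\<lambda>l. norm (E l s0) / c) \<longlongrightarrow> 0) (at l0)"
      using tendsto_divide[OF tendsto_norm[OF lim0] tendsto_const[of c]] c(1) by simp
  qed
  \<comment> \<open>Difference quotient of \<open>E l\<close> between \<open>s0\<close> and
    \<open>S l\<close>. The default value in the case \<open>S l = s0\<close> keeps it nonzero and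
    consistent with the limit.\<close>
  define q where "q l = (if S l = s0 then e l s0 else (E l (S l) - E l s0) / (S l - s0))" for l
  have elim: "((\<lambda>l. e l s0) \<longlongrightarrow> e l0 s0) (at l0)"
    using hole[OF s0] W l0 by (metis holomorphic_on_imp_continuous_on continuous_on_def at_within_open)
  have qdiff: "((\<lambda>l. q l - e l s0) \<longlongrightarrow> 0) (at l0)"
  proof (rule Lim_null_comparison)
    have "\<forall>\<^sub>F l in at l0. dist (S l - s0) 0 < r/2" using tendstoD[OF Slim, of "r/2"] r by auto
    with evW show "\<forall>\<^sub>F l in at l0. norm (q l - e l s0) \<le> K * norm (S l - s0)"
    proof eventually_elim
      case (elim l)
      show ?case
      proof (cases "S l = s0")
        case False
        have h: "E l holomorphic_on ball s0 r"
          by (meson dE elim(1) r(2) subsetD holomorphic_on_open open_ball)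
        have e': "deriv (E l) s0 = e l s0" using dE[OF elim(1) s0] by (rule DERIV_imp_deriv)
        have "norm (E l (S l) - E l s0 - deriv (E l) s0 * (S l - s0)) \<le> K * (norm (S l - s0))\<^sup>2"
          unfolding K_def
        proof (rule norm_quadratic_remainder_le[OF h])
          show "dist s0 (S l) \<le> r / 2" using elim(2) by (simp add: dist_norm norm_minus_commute)
        qed (use r bd[OF elim(1)] in auto)
        moreover have "q l - e l s0 = (E l (S l) - E l s0 - deriv (E l) s0 * (S l - s0)) / (S l - s0)"
          using False by (simp add: q_def e' field_simps)
        ultimately have "norm (q l - e l s0) \<le> K * (norm (S l - s0))\<^sup>2 / norm (S l - s0)"
          by (simp add: norm_divide divide_right_mono)
        then show ?thesis using False by (simp add: power2_eq_square)
      qed (simp add: q_def)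
    qed
    show "((\<lambda>l. K * norm (S l - s0)) \<longlongrightarrow> 0) (at l0)"
      using tendsto_mult[OF tendsto_const[of K] tendsto_norm[OF Slim]] by simp
  qed
  have qlim: "(q \<longlongrightarrow> e l0 s0) (at l0)" using tendsto_add[OF qdiff elim] by simp
  have "((\<lambda>l. - ((E l s0 - E l0 s0) / (l - l0)) / q l) \<longlongrightarrow> - D / e l0 s0) (at l0)"
    using dD qlim nz[OF l0 s0] unfolding has_field_derivative_iff by (intro tendsto_intros) auto
  moreover have "\<forall>\<^sub>F l in at l0. - ((E l s0 - E l0 s0) / (l - l0)) / q l = (S l - S l0) / (l - l0)"
    using evW
  proof eventually_elim
    case (elim l)
    have "q l * (S l - s0) = - E l s0" using zero[OF elim] by (auto simp: q_def)
    moreover have "q l \<noteq> 0"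
      using nz[OF elim s0] c(2)[OF elim S[OF elim] s0] c(1) by (auto simp: q_def mult_le_0_iff)
    ultimately have "S l - s0 = - E l s0 / q l" by (simp add: field_simps)
    then show ?case using zero[OF l0] by (simp add: s0_def)
  qed
  ultimately have "(S has_field_derivative - D / e l0 s0) (at l0)"
    unfolding has_field_derivative_iff by (rule Lim_transform_eventually)
  then show "\<exists>f'. (S has_field_derivative f') (at l0)" by blast
qed

lemma (in prob_space) integrable_bounded:
  fixes g :: "'a \<Rightarrow> 'b::{banach, second_countable_topology}"
  assumes "g \<in> borel_measurable M" "\<And>x. x \<in> space M \<Longrightarrow> norm (g x) \<le> B"
  shows "integrable M g" "norm (integral\<^sup>L M g) \<le> B"
proof -
  show i: "integrable M g"
    by (rule integrable_const_bound[of _ B]) (use assms in auto)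
  have "norm (integral\<^sup>L M g) \<le> (\<integral>x. norm (g x) \<partial>M)" by (rule integral_norm_bound)
  also have "\<dots> \<le> (\<integral>x. B \<partial>M)" using i assms by (intro integral_mono) auto
  finally show "norm (integral\<^sup>L M g) \<le> B" by (simp add: prob_space)
qed

text \<open>Differentiation under the integral sign. A bound on \<open>f\<close> is enough to
  dominate the difference quotients: on a half ball they are at most \<open>4 * B / r\<close>,
  uniformly in \<open>x\<close>, and constants are integrable.\<close>

lemma (in finite_measure) holomorphic_on_integral:
  fixes f :: "complex \<Rightarrow> 'a \<Rightarrow> complex"
  assumes W: "open W"
    and meas: "\<And>l. l \<in> W \<Longrightarrow> f l \<in> borel_measurable M"
    and hol: "\<And>x. x \<in> space M \<Longrightarrow> (\<lambda>l. f l x) holomorphic_on W"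
    and bd: "\<And>l x. l \<in> W \<Longrightarrow> x \<in> space M \<Longrightarrow> norm (f l x) \<le> B"
  shows "(\<lambda>l. \<integral>x. f l x \<partial>M) holomorphic_on W"
proof (subst holomorphic_on_open[OF W], safe)
  fix l0 assume l0: "l0 \<in> W"
  obtain r where r: "r > 0" "ball l0 r \<subseteq> W" using W l0 open_contains_ball by blast
  define g where "g x = deriv (\<lambda>l. f l x) l0" for x
  have int: "integrable M (f l)" if "l \<in> W" for l
    by (rule integrable_const_bound[of _ B]) (use that meas bd in auto)
  have lim: "((\<lambda>l. (f l x - f l0 x) / (l - l0)) \<longlongrightarrow> g x) (at l0)" if "x \<in> space M" for x
    using holomorphic_derivI[OF hol[OF that] W l0] unfolding has_field_derivative_iff g_def .
  have "((\<lambda>l. \<integral>x. (f l x - f l0 x) / (l - l0) \<partial>M) \<longlongrightarrow> (\<integral>x. g x \<partial>M)) (at l0)"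
  proof (subst tendsto_at_iff_sequentially, intro allI impI, unfold comp_def)
    fix X assume X: "\<forall>i. X i \<in> UNIV - {l0}" "X \<longlonglongrightarrow> l0"
    obtain N where N: "\<And>n. n \<ge> N \<Longrightarrow> dist (X n) l0 < r/2"
      using X(2) r(1) by (meson half_gt_zero lim_sequentially)
    \<comment> \<open>The shifted sequence lies entirely in the half ball, where the dominating
      constant is valid.\<close>
    define Y where "Y n = X (n + N)" for n
    have Y: "Y n \<noteq> l0" "dist l0 (Y n) < r/2" for n
      using X N[of "n+N"] by (auto simp: Y_def dist_commute)
    have Ylim: "Y \<longlonglongrightarrow> l0"
      unfolding Y_def using X(2) by (rule LIMSEQ_ignore_initial_segment)
    have YO: "Y n \<in> W" for n
    proof -
      have "dist l0 (Y n) < r" using Y(2)[of n] r(1) by simp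
      then show ?thesis using r(2) by auto
    qed
    have limY: "(\<lambda>n. (f (Y n) x - f l0 x) / (Y n - l0)) \<longlonglongrightarrow> g x" if "x \<in> space M" for x
      using lim[OF that] Y Ylim unfolding tendsto_at_iff_sequentially comp_def by blast
    have m: "(\<lambda>x. (f (Y n) x - f l0 x) / (Y n - l0)) \<in> borel_measurable M" for n
      using meas[OF YO] meas[OF l0] by measurable
    have "(\<lambda>n. \<integral>x. (f (Y n) x - f l0 x) / (Y n - l0) \<partial>M) \<longlonglongrightarrow> (\<integral>x. g x \<partial>M)"
    proof (rule integral_dominated_convergence[where w = "\<lambda>_. 4 * B / r"])
      \<comment> \<open>The derivative is measurable as a pointwise limit of measurable difference
        quotients.\<close>
      show "g \<in> borel_measurable M"
        using limY m by (rule borel_measurable_LIMSEQ_metric[rotated])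
      show "AE x in M. (\<lambda>n. (f (Y n) x - f l0 x) / (Y n - l0)) \<longlonglongrightarrow> g x" using limY by auto
      show "AE x in M. norm ((f (Y n) x - f l0 x) / (Y n - l0)) \<le> 4 * B / r" for n
      proof (rule AE_I2)
        fix x assume x: "x \<in> space M"
        have "norm (f (Y n) x - f l0 x) \<le> 4 * B / r * norm (Y n - l0)"
          using hol[OF x] bd[OF _ x] r Y(2)[of n]
          by (intro norm_diff_le_bounded_holomorphic) (auto intro: holomorphic_on_subset)
        then show "norm ((f (Y n) x - f l0 x) / (Y n - l0)) \<le> 4 * B / r"
          using Y(1)[of n] by (simp add: norm_divide pos_divide_le_eq)
      qed
    qed (use m in auto)
    then show "(\<lambda>n. \<integral>x. (f (X n) x - f l0 x) / (X n - l0) \<partial>M) \<longlonglongrightarrow> (\<integral>x. g x \<partial>M)"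
      unfolding Y_def by (rule LIMSEQ_offset)
  qed
  moreover have "\<forall>\<^sub>F l in at l0. l \<in> W" using W l0 by (simp add: eventually_at_in_open')
  then have "\<forall>\<^sub>F l in at l0. (\<integral>x. (f l x - f l0 x) / (l - l0) \<partial>M)
      = ((\<integral>x. f l x \<partial>M) - (\<integral>x. f l0 x \<partial>M)) / (l - l0)"
    by eventually_elim (use int l0 in simp)
  ultimately have "((\<lambda>l. \<integral>x. f l x \<partial>M) has_field_derivative (\<integral>x. g x \<partial>M)) (at l0)"
    unfolding has_field_derivative_iff by (rule Lim_transform_eventually)
  then show "\<exists>f'. ((\<lambda>l. \<integral>x. f l x \<partial>M) has_field_derivative f') (at l0)" by blast
qed

subsection \<open>Holomorphy in several variables\<close>

text \<open>
  For bounded functions on a polydisc neighbourhood, Frechet holomorphy is equivalent to holomorphy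
  along all holomorphic curves. The latter is trivially stable under composition and turns
  parametric integrals and implicit functions into one-variable problems.
\<close>

definition curve_holomorphic :: "((nat \<Rightarrow> complex) \<Rightarrow> complex) \<Rightarrow> (nat \<Rightarrow> complex) set \<Rightarrow> bool" where
  "curve_holomorphic F U \<longleftrightarrow>
     (\<forall>\<gamma> W. open W \<longrightarrow> (\<forall>i. (\<lambda>l. \<gamma> l i) holomorphic_on W) \<longrightarrow> (\<forall>l\<in>W. \<gamma> l \<in> U) \<longrightarrow>
       (\<lambda>l. F (\<gamma> l)) holomorphic_on W)"

lemma curve_holomorphicD:
  assumes "curve_holomorphic F U" "open W" "\<And>i. (\<lambda>l. \<gamma> l i) holomorphic_on W" "\<And>l. l \<in> W \<Longrightarrow> \<gamma> l \<in> U"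
  shows "(\<lambda>l. F (\<gamma> l)) holomorphic_on W"
  using assms unfolding curve_holomorphic_def by blast

lemma curve_holomorphic_divide:
  assumes "curve_holomorphic F U" "curve_holomorphic G U" "\<And>z. z \<in> U \<Longrightarrow> G z \<noteq> 0"
  shows "curve_holomorphic (\<lambda>z. F z / G z) U"
  using assms unfolding curve_holomorphic_def by (auto intro!: holomorphic_on_divide)

lemma curve_holomorphic_subset:
  "curve_holomorphic F U \<Longrightarrow> V \<subseteq> U \<Longrightarrow> curve_holomorphic F V"
  unfolding curve_holomorphic_def by blast

lemma curve_holomorphic_line:
  assumes "curve_holomorphic F U" "open W" "\<And>s. s \<in> W \<Longrightarrow> z(k := s) \<in> U"
  shows "(\<lambda>s. F (z(k := s))) holomorphic_on W"
proof (rule curve_holomorphicD[where \<gamma> = "\<lambda>s. z(k := s)", OF assms(1,2)])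
  show "(\<lambda>s. (z(k := s)) i) holomorphic_on W" for i
    by (cases "i = k") auto
qed (use assms(3) in auto)

lemma L2_set_le_const_mult:
  assumes "\<And>i. i \<in> A \<Longrightarrow> norm (f i :: complex) \<le> c i * t" "0 \<le> t"
  shows "L2_set (\<lambda>i. norm (f i)) A \<le> (\<Sum>i\<in>A. c i) * t"
proof -
  have "L2_set (\<lambda>i. norm (f i)) A \<le> (\<Sum>i\<in>A. norm (f i))" by (rule L2_set_le_sum) auto
  also have "\<dots> \<le> (\<Sum>i\<in>A. c i * t)" using assms by (intro sum_mono) auto
  finally show ?thesis by (simp add: sum_distrib_right)
qed

text \<open>The chain rule: the increment of \<open>\<gamma>\<close> is at most \<open>C\<close>
  times \<open>norm (l - l0)\<close> near \<open>l0\<close>, so the Frechet remainder stays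
  negligible after division by \<open>l - l0\<close>.\<close>

lemma holomorphic_nvar_imp_curve:
  assumes "holomorphic_nvar n F U"
  shows "curve_holomorphic F U"
  unfolding curve_holomorphic_def
proof (intro allI impI)
  fix \<gamma> :: "complex \<Rightarrow> nat \<Rightarrow> complex" and W :: "complex set"
  assume W: "open W" and hol: "\<forall>i. (\<lambda>l. \<gamma> l i) holomorphic_on W" and U: "\<forall>l\<in>W. \<gamma> l \<in> U"
  show "(\<lambda>l. F (\<gamma> l)) holomorphic_on W"
  proof (subst holomorphic_on_open[OF W], safe)
    fix l0 assume l0: "l0 \<in> W"
    define N where "N l = L2_set (\<lambda>i. cmod (\<gamma> l i - \<gamma> l0 i)) {1..n}" for l
    obtain a where a: "\<And>e. 0 < e \<Longrightarrow> \<exists>\<eta>>0. \<forall>w\<in>U. L2_set (\<lambda>i. cmod (w i - \<gamma> l0 i)) {1..n} < \<eta> \<longrightarrow>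
        cmod (F w - F (\<gamma> l0) - (\<Sum>i\<in>{1..n}. a i * (w i - \<gamma> l0 i)))
          \<le> e * L2_set (\<lambda>i. cmod (w i - \<gamma> l0 i)) {1..n}"
      using assms U l0 unfolding holomorphic_nvar_def by blast
    define g where "g i = deriv (\<lambda>l. \<gamma> l i) l0" for i
    have g: "((\<lambda>l. \<gamma> l i) has_field_derivative g i) (at l0)" for i
      unfolding g_def using hol W l0 holomorphic_derivI by blast
    \<comment> \<open>Each inner 1 is slack above the limit \<open>norm (g i)\<close> of the
      quotients; the outer 1 keeps \<open>C\<close> positive for \<open>n = 0\<close>.\<close>
    define C where "C = (\<Sum>i\<in>{1..n}. norm (g i) + 1) + 1"
    have C: "C > 0" unfolding C_def by (intro add_nonneg_pos sum_nonneg) auto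
    have evW: "\<forall>\<^sub>F l in at l0. l \<in> W" using W l0 by (simp add: eventually_at_in_open')
    have "\<forall>\<^sub>F l in at l0. norm (\<gamma> l i - \<gamma> l0 i) \<le> (norm (g i) + 1) * norm (l - l0)" for i
    proof -
      have "((\<lambda>l. norm ((\<gamma> l i - \<gamma> l0 i) / (l - l0))) \<longlongrightarrow> norm (g i)) (at l0)"
        using g[of i] unfolding has_field_derivative_iff by (intro tendsto_norm)
      then have "\<forall>\<^sub>F l in at l0. norm ((\<gamma> l i - \<gamma> l0 i) / (l - l0)) < norm (g i) + 1"
        by (rule order_tendstoD) simp
      then show ?thesis
        by eventually_elim (auto simp: norm_divide divide_less_eq split: if_splits)
    qed
    then have "\<forall>\<^sub>F l in at l0. \<forall>i\<in>{1..n}. norm (\<gamma> l i - \<gamma> l0 i) \<le> (norm (g i) + 1) * norm (l - l0)"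
      by (simp add: eventually_ball_finite_distrib)
    then have evN: "\<forall>\<^sub>F l in at l0. N l \<le> C * norm (l - l0)"
    proof eventually_elim
      case (elim l)
      then have "N l \<le> (\<Sum>i\<in>{1..n}. norm (g i) + 1) * norm (l - l0)"
        unfolding N_def by (intro L2_set_le_const_mult) auto
      also have "\<dots> \<le> C * norm (l - l0)" unfolding C_def by (intro mult_right_mono) auto
      finally show ?case .
    qed
    have "((\<lambda>l. (F (\<gamma> l) - F (\<gamma> l0)) / (l - l0) - (\<Sum>i\<in>{1..n}. a i * ((\<gamma> l i - \<gamma> l0 i) / (l - l0)))) \<longlongrightarrow> 0) (at l0)"
    proof (rule tendstoI)
      fix e :: real assume e: "0 < e"
      obtain \<eta> where \<eta>: "\<eta> > 0" "\<And>w. w \<in> U \<Longrightarrow> L2_set (\<lambda>i. cmod (w i - \<gamma> l0 i)) {1..n} < \<eta> \<Longrightarrow>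
        cmod (F w - F (\<gamma> l0) - (\<Sum>i\<in>{1..n}. a i * (w i - \<gamma> l0 i)))
          \<le> e / (2 * C) * L2_set (\<lambda>i. cmod (w i - \<gamma> l0 i)) {1..n}"
        using a[of "e / (2 * C)"] e C by auto
      have "((\<lambda>l. C * norm (l - l0)) \<longlongrightarrow> C * norm (l0 - l0)) (at l0)" by (intro tendsto_intros)
      then have "\<forall>\<^sub>F l in at l0. C * norm (l - l0) < \<eta>"
        using \<eta>(1) by (intro order_tendstoD) auto
      moreover have "\<forall>\<^sub>F l in at l0. l \<noteq> l0" by (simp add: eventually_neq_at_within)
      ultimately show "\<forall>\<^sub>F l in at l0. dist ((F (\<gamma> l) - F (\<gamma> l0)) / (l - l0) - (\<Sum>i\<in>{1..n}. a i * ((\<gamma> l i - \<gamma> l0 i) / (l - l0)))) 0 < e"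
        using evN evW
      proof eventually_elim
        case (elim l)
        have "N l < \<eta>" using elim by linarith
        then have "cmod (F (\<gamma> l) - F (\<gamma> l0) - (\<Sum>i\<in>{1..n}. a i * (\<gamma> l i - \<gamma> l0 i))) \<le> e / (2 * C) * N l"
          using \<eta>(2)[of "\<gamma> l"] U elim unfolding N_def by blast
        also have "\<dots> \<le> e / (2 * C) * (C * norm (l - l0))"
          using elim e C by (intro mult_left_mono) auto
        also have "\<dots> = e / 2 * norm (l - l0)" using C by simp
        also have "\<dots> < e * norm (l - l0)" using e elim by simp
        finally have "cmod (F (\<gamma> l) - F (\<gamma> l0) - (\<Sum>i\<in>{1..n}. a i * (\<gamma> l i - \<gamma> l0 i))) / norm (l - l0) < e"
          using elim by (simp add: pos_divide_less_eq)
        moreover have "(F (\<gamma> l) - F (\<gamma> l0)) / (l - l0) - (\<Sum>i\<in>{1..n}. a i * ((\<gamma> l i - \<gamma> l0 i) / (l - l0)))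
          = (F (\<gamma> l) - F (\<gamma> l0) - (\<Sum>i\<in>{1..n}. a i * (\<gamma> l i - \<gamma> l0 i))) / (l - l0)"
          by (simp only: diff_divide_distrib[of _ "\<Sum>i\<in>_. _ i"] sum_divide_distrib times_divide_eq_right)
        ultimately show ?case by (simp add: norm_divide)
      qed
    qed
    note tendsto_add[OF this, of "\<lambda>l. \<Sum>i\<in>{1..n}. a i * ((\<gamma> l i - \<gamma> l0 i) / (l - l0))" "\<Sum>i\<in>{1..n}. a i * g i"]
    moreover have "((\<lambda>l. \<Sum>i\<in>{1..n}. a i * ((\<gamma> l i - \<gamma> l0 i) / (l - l0))) \<longlongrightarrow> (\<Sum>i\<in>{1..n}. a i * g i)) (at l0)"
      using g unfolding has_field_derivative_iff by (intro tendsto_intros)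
    ultimately have "((\<lambda>l. F (\<gamma> l)) has_field_derivative (\<Sum>i\<in>{1..n}. a i * g i)) (at l0)"
      unfolding has_field_derivative_iff by simp
    then show "\<exists>f'. ((\<lambda>l. F (\<gamma> l)) has_field_derivative f') (at l0)" by blast
  qed
qed

text \<open>
  Telescope \<open>F w - F z\<close> along the coordinates. Cauchy's estimates bound the one-variable
  remainders and the variation of the partial derivatives by the square of the distance.
\<close>

lemma curve_holomorphic_remainder_bound:
  fixes z :: "nat \<Rightarrow> complex"
  assumes hol: "curve_holomorphic F U" and r: "0 < r"
    and U: "\<And>w. (\<And>i. i \<in> {1..n} \<Longrightarrow> norm (w i - z i) < r) \<Longrightarrow> (\<And>i. i \<notin> {1..n} \<Longrightarrow> w i = z i) \<Longrightarrow> w \<in> U"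
    and bd: "\<And>w. w \<in> U \<Longrightarrow> norm (F w) \<le> B"
    and w: "\<And>i. i \<in> {1..n} \<Longrightarrow> norm (w i - z i) \<le> \<nu>" "\<And>i. i \<notin> {1..n} \<Longrightarrow> w i = z i"
    and \<nu>: "0 < \<nu>" "\<nu> \<le> r / 2"
  shows "norm (F w - F z - (\<Sum>i\<in>{1..n}. deriv (\<lambda>s. F (z(i := s))) (z i) * (w i - z i))) \<le> real n * (48 * B / r\<^sup>2) * \<nu>\<^sup>2"
proof -
  \<comment> \<open>The telescoping path: \<open>p j\<close> has already moved its first
    \<open>j\<close> coordinates from \<open>z\<close> to \<open>w\<close>.\<close>
  define p where "p j = (\<lambda>i. if i \<in> {1..j} then w i else z i)" for j :: nat
  have p0: "p 0 = z" and pn: "p n = w" using w(2) by (auto simp: p_def fun_eq_iff)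
  have line: "(\<lambda>s. F (u(j := s))) holomorphic_on ball (z j) r"
    if "\<And>i. i \<in> {1..n} \<Longrightarrow> norm (u i - z i) < r" "\<And>i. i \<notin> {1..n} \<Longrightarrow> u i = z i" "j \<in> {1..n}" for u j
    using that by (intro curve_holomorphic_line[OF hol] U) (auto simp: dist_norm norm_minus_commute)
  have lineU: "u(j := s) \<in> U"
    if "\<And>i. i \<in> {1..n} \<Longrightarrow> norm (u i - z i) < r" "\<And>i. i \<notin> {1..n} \<Longrightarrow> u i = z i" "j \<in> {1..n}" "s \<in> ball (z j) r" for u j s
    using that by (intro U) (auto simp: dist_norm norm_minus_commute)
  have pz: "norm (p j i - z i) \<le> \<nu>" if "i \<in> {1..n}" for i j
    using w(1)[OF that] \<nu>(1) by (auto simp: p_def)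
  have pz': "p j i = z i" if "i \<notin> {1..n}" for i j
    using w(2)[OF that] by (auto simp: p_def)
  have pr: "norm (p j i - z i) < r" if "i \<in> {1..n}" for i j
    using pz[OF that] \<nu> r by (smt (verit) field_sum_of_halves)
  have step: "norm (F (p j) - F (p (j - 1)) - deriv (\<lambda>s. F (z(j := s))) (z j) * (w j - z j)) \<le> 48 * B / r\<^sup>2 * \<nu>\<^sup>2"
    if j: "j \<in> {1..n}" for j
  proof -
    define g where "g s = F ((p (j - 1))(j := s))" for s
    define h where "h s = F (z(j := s))" for s
    have gz: "g (z j) = F (p (j - 1))" "g (w j) = F (p j)"
    proof -
      have "(p (j - 1))(j := z j) = p (j - 1)" "(p (j - 1))(j := w j) = p j"
        using j by (rule_tac [!] ext) (auto simp: p_def)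
      then show "g (z j) = F (p (j - 1))" "g (w j) = F (p j)" by (simp_all only: g_def)
    qed
    have gh: "g holomorphic_on ball (z j) r" and hh: "h holomorphic_on ball (z j) r"
      unfolding g_def h_def using pr pz' r j by (auto intro!: line)
    have gb: "norm (g s) \<le> B" if "s \<in> ball (z j) r" for s
      unfolding g_def using pr pz' j that by (intro bd lineU) auto
    have 1: "norm (g (w j) - g (z j) - deriv g (z j) * (w j - z j)) \<le> 32 * B / r\<^sup>2 * (norm (w j - z j))\<^sup>2"
      using gb \<nu> w(1)[OF j] r
      by (intro norm_quadratic_remainder_le[OF gh]) (auto simp: dist_norm norm_minus_commute)
    have B0: "0 \<le> B" using gb[of "z j"] r by (meson centre_in_ball norm_ge_zero order_trans)
    \<comment> \<open>The expansion of \<open>g\<close> involves the partial derivative at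
      \<open>p (j - 1)\<close>, whereas the claim has the one at \<open>z\<close>, which is that of
      \<open>h\<close>. A bound for \<open>g - h\<close> on the whole disc yields one for the
      difference of the derivatives.\<close>
    have "norm (deriv (\<lambda>s. g s - h s) (z j)) \<le> 2 * (4 * B / r * \<nu>) / r"
    proof (rule norm_deriv_le)
      show "(\<lambda>s. g s - h s) holomorphic_on ball (z j) r" using gh hh by (intro holomorphic_intros)
      fix s assume s: "s \<in> ball (z j) r"
      \<comment> \<open>Complex line from \<open>z\<close> to \<open>p (j - 1)\<close> with
        coordinate \<open>j\<close> frozen at \<open>s\<close>. Its speed is at most
        \<open>\<nu>\<close> in each coordinate, so it stays in \<open>U\<close> for
        \<open>norm l < r / \<nu>\<close>; on so large a disc a function bounded by \<open>B\<close>
        changes over a unit step by at most \<open>4 * B / r * \<nu>\<close>.\<close>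
      define \<gamma> where "\<gamma> l = (\<lambda>i. z i + l * (p (j-1) i - z i))(j := s)" for l
      have "norm (F (\<gamma> 1) - F (\<gamma> 0)) \<le> 4 * B / (r / \<nu>) * norm (1 - 0 :: complex)"
      proof (rule norm_diff_le_bounded_holomorphic)
        have \<gamma>U: "\<gamma> l \<in> U" if "l \<in> ball 0 (r / \<nu>)" for l
        proof (unfold \<gamma>_def, rule lineU[OF _ _ j s])
          fix i assume i: "i \<in> {1..n}"
          have "norm l * norm (p (j-1) i - z i) \<le> norm l * \<nu>"
            using pz[OF i] by (intro mult_left_mono) auto
          also have "\<dots> < r" using that \<nu> by (simp add: field_simps)
          finally show "norm (z i + l * (p (j-1) i - z i) - z i) < r" by (simp add: norm_mult)
        qed (use pz' in auto)
        show "(\<lambda>l. F (\<gamma> l)) holomorphic_on ball 0 (r / \<nu>)"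
        proof (rule curve_holomorphicD[where \<gamma> = \<gamma>, OF hol _ _ \<gamma>U])
          show "(\<lambda>l. \<gamma> l i) holomorphic_on ball 0 (r / \<nu>)" for i
            by (cases "i = j") (auto simp: \<gamma>_def intro!: holomorphic_intros)
        qed auto
        show "norm (F (\<gamma> l)) \<le> B" if "l \<in> ball 0 (r / \<nu>)" for l using \<gamma>U[OF that] by (rule bd)
      qed (use r \<nu> in \<open>auto simp: field_simps\<close>)
      moreover have "\<gamma> 1 = (p (j - 1))(j := s)" "\<gamma> 0 = z(j := s)" by (auto simp: \<gamma>_def)
      ultimately show "norm (g s - h s) \<le> 4 * B / r * \<nu>" by (simp add: g_def h_def)
    qed (use r in auto)
    moreover have "deriv (\<lambda>s. g s - h s) (z j) = deriv g (z j) - deriv h (z j)"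
      using gh hh r by (intro deriv_diff) (auto intro: holomorphic_on_imp_differentiable_at)
    ultimately have "norm ((deriv g (z j) - deriv h (z j)) * (w j - z j)) \<le> 8 * B / r\<^sup>2 * \<nu> * norm (w j - z j)"
      unfolding norm_mult by (intro mult_right_mono) (auto simp: power2_eq_square mult.assoc)
    also have "\<dots> \<le> 8 * B / r\<^sup>2 * \<nu> * \<nu>"
      using w(1)[OF j] B0 \<nu> by (intro mult_left_mono) auto
    finally have 2: "norm ((deriv g (z j) - deriv h (z j)) * (w j - z j)) \<le> 8 * B / r\<^sup>2 * \<nu>\<^sup>2"
      by (simp add: power2_eq_square mult.assoc)
    have "32 * B / r\<^sup>2 * (norm (w j - z j))\<^sup>2 \<le> 32 * B / r\<^sup>2 * \<nu>\<^sup>2"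
      using w(1)[OF j] B0 by (intro mult_left_mono power_mono) auto
    with 1 have 3: "norm (g (w j) - g (z j) - deriv g (z j) * (w j - z j)) \<le> 32 * B / r\<^sup>2 * \<nu>\<^sup>2" by linarith
    have "g (w j) - g (z j) - deriv h (z j) * (w j - z j) = (g (w j) - g (z j) - deriv g (z j) * (w j - z j))
        + (deriv g (z j) - deriv h (z j)) * (w j - z j)" by (simp add: left_diff_distrib)
    then have "norm (g (w j) - g (z j) - deriv h (z j) * (w j - z j)) \<le> 32 * B / r\<^sup>2 * \<nu>\<^sup>2 + 8 * B / r\<^sup>2 * \<nu>\<^sup>2"
      using norm_triangle_mono[OF 3 2] by (simp only:)
    also have "\<dots> \<le> 48 * B / r\<^sup>2 * \<nu>\<^sup>2" using B0 by (simp add: divide_right_mono flip: distrib_right add_divide_distrib)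
    finally show ?thesis unfolding gz by (simp add: h_def[abs_def])
  qed
  have "F w - F z = (\<Sum>j\<in>{1..n}. F (p j) - F (p (j - 1)))"
  proof -
    have "(\<Sum>j\<in>{1..m}. F (p j) - F (p (j - 1))) = F (p m) - F (p 0)" for m
      by (induction m) auto
    then show ?thesis by (simp add: p0 pn)
  qed
  then have "F w - F z - (\<Sum>i\<in>{1..n}. deriv (\<lambda>s. F (z(i := s))) (z i) * (w i - z i))
     = (\<Sum>j\<in>{1..n}. F (p j) - F (p (j - 1)) - deriv (\<lambda>s. F (z(j := s))) (z j) * (w j - z j))"
    by (simp add: sum_subtractf)
  also have "norm \<dots> \<le> (\<Sum>j\<in>{1..n}. 48 * B / r\<^sup>2 * \<nu>\<^sup>2)" using step by (rule sum_norm_le)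
  finally show ?thesis by simp
qed

text \<open>Unlike \<open>poly_nbhd\<close>, this leaves the coordinates outside
  \<open>{1..n}\<close> free. One vector can then be an argument at every level \<open>k\<close>,
  and lowering the level or updating coordinate \<open>k\<close> requires no restriction of the
  function.\<close>

definition poly_dom :: "nat \<Rightarrow> (nat \<Rightarrow> real) \<Rightarrow> (nat \<Rightarrow> complex) set" where
  "poly_dom n r = {z. \<forall>i\<in>{1..n}. z i \<in> nbhd (r i) cinterval}"

lemma poly_nbhd_subset_dom: "poly_nbhd n r cinterval \<subseteq> poly_dom n r"
  by (auto simp: poly_nbhd_def poly_dom_def)

lemma open_nbhd: "open (nbhd r S)"
proof -
  have "nbhd r S = (\<Union>y\<in>S. ball y r)" by (auto simp: nbhd_def dist_norm norm_minus_commute)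
  then show ?thesis by (metis open_UN open_ball)
qed

text \<open>The partial derivatives form the Frechet derivative: a remainder \<open>K\<close> times
  the squared distance is below \<open>e\<close> times the distance once the latter is at most
  \<open>e / (\<bar>K\<bar> + 1)\<close>.\<close>

lemma curve_holomorphic_imp_nvar:
  assumes hol: "curve_holomorphic F (poly_dom n \<delta>)"
    and bd: "\<And>w. w \<in> poly_dom n \<delta> \<Longrightarrow> norm (F w) \<le> B"
  shows "holomorphic_nvar n F (poly_nbhd n \<delta> cinterval)"
  unfolding holomorphic_nvar_def
proof (rule ballI, rule exI, intro allI impI)
  fix z :: "nat \<Rightarrow> complex" and e :: real assume z: "z \<in> poly_nbhd n \<delta> cinterval" and e: "0 < e"
  have "\<exists>r>0. ball (z i) r \<subseteq> nbhd (\<delta> i) cinterval" if "i \<in> {1..n}" for i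
  proof -
    have "z i \<in> nbhd (\<delta> i) cinterval" using that z by (auto simp: poly_nbhd_def PiE_iff)
    then show ?thesis using open_nbhd[of "\<delta> i" cinterval] open_contains_ball by blast
  qed
  then obtain \<rho> where \<rho>: "\<And>i. i \<in> {1..n} \<Longrightarrow> \<rho> i > 0 \<and> ball (z i) (\<rho> i) \<subseteq> nbhd (\<delta> i) cinterval" by metis
  \<comment> \<open>The element 1 keeps the minimum meaningful for \<open>n = 0\<close>.\<close>
  define r where "r = Min (insert 1 (\<rho> ` {1..n}))"
  have r: "0 < r" using \<rho> by (auto simp: r_def)
  have r\<rho>: "r \<le> \<rho> i" if "i \<in> {1..n}" for i unfolding r_def using that by (intro Min_le) auto
  have U: "w \<in> poly_dom n \<delta>" if w: "\<And>i. i \<in> {1..n} \<Longrightarrow> norm (w i - z i) < r" for w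
    unfolding poly_dom_def
  proof safe
    fix i assume i: "i \<in> {1..n}"
    have "w i \<in> ball (z i) (\<rho> i)" using w[OF i] r\<rho>[OF i] by (simp add: dist_norm norm_minus_commute)
    then show "w i \<in> nbhd (\<delta> i) cinterval" using \<rho>[OF i] by blast
  qed
  define K where "K = real n * (48 * B / r\<^sup>2)"
  define \<eta> where "\<eta> = min (r / 2) (e / (\<bar>K\<bar> + 1))"
  let ?a = "\<lambda>i. deriv (\<lambda>s. F (z(i := s))) (z i)"
  let ?N = "\<lambda>w. L2_set (\<lambda>i. cmod (w i - z i)) {1..n}"
  have "\<eta> > 0" using r e unfolding \<eta>_def by (simp add: add_nonneg_pos)
  moreover have "cmod (F w - F z - (\<Sum>i\<in>{1..n}. ?a i * (w i - z i))) \<le> e * ?N w"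
    if w: "w \<in> poly_nbhd n \<delta> cinterval" and Nw: "?N w < \<eta>" for w
  proof -
    \<comment> \<open>Extensionality makes \<open>w\<close> and \<open>z\<close> agree outside
      \<open>{1..n}\<close>, so that telescoping over \<open>{1..n}\<close> leads from one to the
      other.\<close>
    have ext: "w i = z i" if "i \<notin> {1..n}" for i
      using w z that by (auto simp: poly_nbhd_def PiE_def extensional_def)
    have le: "norm (w i - z i) \<le> ?N w" if "i \<in> {1..n}" for i
      using that member_le_L2_set[of "{1..n}" i "\<lambda>i. cmod (w i - z i)"] by auto
    show ?thesis
    proof (cases "?N w = 0")
      case True
      have "w = z"
      proof
        show "w i = z i" for i
          using ext[of i] le[of i] True by (cases "i \<in> {1..n}") auto
      qed
      then show ?thesis by (simp add: L2_set_def)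
    next
      case False
      then have pos: "?N w > 0" using L2_set_nonneg[of "\<lambda>i. cmod (w i - z i)" "{1..n}"] by linarith
      have "cmod (F w - F z - (\<Sum>i\<in>{1..n}. ?a i * (w i - z i))) \<le> K * (?N w)\<^sup>2"
        unfolding K_def using Nw
        by (intro curve_holomorphic_remainder_bound[OF hol r U bd le ext pos]) (simp_all add: \<eta>_def)
      also have "\<dots> \<le> (\<bar>K\<bar> + 1) * (?N w)\<^sup>2" by (intro mult_right_mono) auto
      also have "\<dots> = ((\<bar>K\<bar> + 1) * ?N w) * ?N w" by (simp add: power2_eq_square)
      also have "\<dots> \<le> e * ?N w"
      proof (rule mult_right_mono)
        have "?N w \<le> e / (\<bar>K\<bar> + 1)" using Nw by (simp add: \<eta>_def)
        then show "(\<bar>K\<bar> + 1) * ?N w \<le> e" by (simp add: pos_le_divide_eq mult.commute)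
      qed (use pos in auto)
      finally show ?thesis .
    qed
  qed
  ultimately show "\<exists>\<eta>>0. \<forall>w\<in>poly_nbhd n \<delta> cinterval. ?N w < \<eta> \<longrightarrow>
     cmod (F w - F z - (\<Sum>i\<in>{1..n}. ?a i * (w i - z i))) \<le> e * ?N w" by blast
qed

subsection \<open>Complexified marginals\<close>

lemma space_half_lebesgue [simp]: "space half_lebesgue = {-1..1}"
  by (simp add: half_lebesgue_def space_restrict_space)

lemma sets_half_lebesgue: "sets half_lebesgue = sets (restrict_space borel {-1..1})"
  by (simp add: half_lebesgue_def sets_restrict_space)

lemma prob_space_half_lebesgue: "prob_space half_lebesgue"
proof
  have "emeasure half_lebesgue {-1..1} = ennreal (1/2) * emeasure (restrict_space lborel {-1..1}) {-1..1::real}"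
    unfolding half_lebesgue_def
    by (subst emeasure_density) (auto simp: sets_restrict_space_iff nn_integral_cmult_indicator)
  also have "\<dots> = ennreal (1/2) * ennreal 2"
    by (subst emeasure_restrict_space) auto
  also have "\<dots> = 1" by (subst ennreal_mult[symmetric]) auto
  finally show "emeasure half_lebesgue (space half_lebesgue) = 1" by simp
qed

lemma measurable_half_lebesgue_id: "(\<lambda>x. x) \<in> borel_measurable half_lebesgue"
  by (subst measurable_cong_sets[OF sets_half_lebesgue refl]) (rule measurable_restrict_space1, simp)

lemma integral_half_lebesgue:
  fixes g :: "real \<Rightarrow> 'a::{banach, second_countable_topology}"
  assumes "g \<in> borel_measurable (restrict_space borel {-1..1})"
  shows "integral\<^sup>L half_lebesgue g = (1/2) *\<^sub>R (LBINT t:{-1..1}. g t)"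
proof -
  have "g \<in> borel_measurable (restrict_space lborel {-1..1})"
    using assms by (subst measurable_cong_sets[where M' = "restrict_space borel {-1..1}"]) (auto simp: sets_restrict_space)
  then have "integral\<^sup>L half_lebesgue g = (\<integral>t. (1/2) *\<^sub>R g t \<partial>restrict_space lborel {-1..1})"
    unfolding half_lebesgue_def by (intro integral_density) auto
  also have "\<dots> = (1/2) *\<^sub>R (\<integral>t. g t \<partial>restrict_space lborel {-1..1})" by simp
  also have "(\<integral>t. g t \<partial>restrict_space lborel {-1..1}) = (LBINT t:{-1..1}. g t)"
    unfolding set_lebesgue_integral_def by (rule integral_restrict_space) simp
  finally show ?thesis .
qed

interpretation hl: product_sigma_finite "\<lambda>_::nat. half_lebesgue"
  unfolding product_sigma_finite_def
  using prob_space_half_lebesgue prob_space_imp_sigma_finite by blast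

lemma prob_space_PiM_half_lebesgue: "prob_space (PiM J (\<lambda>_::nat. half_lebesgue))"
  by (rule prob_space_PiM) (rule prob_space_half_lebesgue)

section \<open>Geometry of complex neighbourhoods of the interval\<close>

lemma convex_nbhd: "convex S \<Longrightarrow> convex (nbhd r S)"
proof (rule convexI)
  fix z w :: complex and u v :: real
  assume S: "convex S" and z: "z \<in> nbhd r S" "w \<in> nbhd r S" and uv: "0 \<le> u" "0 \<le> v" "u + v = 1"
  from z obtain y x where *: "y \<in> S" "norm (z - y) < r" "x \<in> S" "norm (w - x) < r"
    by (auto simp: nbhd_def)
  have "u *\<^sub>R z + v *\<^sub>R w - (u *\<^sub>R y + v *\<^sub>R x) = u *\<^sub>R (z - y) + v *\<^sub>R (w - x)"
    by (simp add: algebra_simps)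
  then have "norm (u *\<^sub>R z + v *\<^sub>R w - (u *\<^sub>R y + v *\<^sub>R x)) \<le> u * norm (z - y) + v * norm (w - x)"
    using uv by (metis abs_of_nonneg norm_scaleR norm_triangle_ineq)
  also have "\<dots> < r" using uv * by (intro convex_bound_lt) auto
  finally show "u *\<^sub>R z + v *\<^sub>R w \<in> nbhd r S"
    using convexD[OF S *(1,3) uv] by (auto simp: nbhd_def)
qed

lemma convex_nbhd_cinterval: "convex (nbhd r cinterval)"
proof -
  have "cinterval = closed_segment (of_real (-1)) (of_real 1)"
    unfolding closed_segment_of_real cinterval_def by (simp add: closed_segment_eq_real_ivl)
  then show ?thesis using convex_nbhd[OF convex_closed_segment] by metis
qed

lemma nbhd_cintervalE:
  assumes "z \<in> nbhd r cinterval"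
  obtains x :: real where "x \<in> {-1..1}" "norm (z - of_real x) < r"
  using assms by (auto simp: nbhd_def cinterval_def)

lemma nbhd_cintervalI: "x \<in> {-1..1} \<Longrightarrow> norm (z - of_real x) < r \<Longrightarrow> z \<in> nbhd r cinterval"
  by (auto simp: nbhd_def cinterval_def)

lemma of_real_in_nbhd: "x \<in> {-1..1} \<Longrightarrow> 0 < r \<Longrightarrow> complex_of_real x \<in> nbhd r cinterval"
  by (rule nbhd_cintervalI[of x]) auto

lemma nbhd_mono: "r \<le> r' \<Longrightarrow> nbhd r S \<subseteq> nbhd r' S"
  by (auto simp: nbhd_def intro: less_le_trans)

lemma ball_subset_nbhd:
  assumes "s \<in> nbhd (r/2) S" shows "ball s (r/2) \<subseteq> nbhd r S"
proof
  fix z assume z: "z \<in> ball s (r/2)"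
  obtain y where y: "y \<in> S" "norm (s - y) < r/2" using assms by (auto simp: nbhd_def)
  have "norm (z - y) \<le> norm (z - s) + norm (s - y)" using norm_triangle_ineq[of "z - s" "s - y"] by simp
  then have "norm (z - y) < r" using z y by (simp add: dist_norm norm_minus_commute)
  with y show "z \<in> nbhd r S" by (auto simp: nbhd_def)
qed

text \<open>Pointwise continuity in a form suited to the product topology: the distance is a finite
  sum of coordinate distances, each of which tends to 0 under coordinatewise convergence.\<close>

lemma holomorphic_nvar_imp_lipschitz:
  assumes "holomorphic_nvar n F U" "z \<in> U"
  shows "\<exists>K \<eta>. 0 < \<eta> \<and> 0 \<le> K \<and> (\<forall>w\<in>U. (\<Sum>i\<in>{1..n}. cmod (w i - z i)) < \<eta> \<longrightarrow>
     cmod (F w - F z) \<le> K * (\<Sum>i\<in>{1..n}. cmod (w i - z i)))"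
proof -
  obtain a \<eta> where \<eta>: "\<eta> > 0" "\<And>w. w \<in> U \<Longrightarrow> L2_set (\<lambda>i. cmod (w i - z i)) {1..n} < \<eta> \<Longrightarrow>
        cmod (F w - F z - (\<Sum>i\<in>{1..n}. a i * (w i - z i))) \<le> 1 * L2_set (\<lambda>i. cmod (w i - z i)) {1..n}"
    using assms unfolding holomorphic_nvar_def by (elim ballE exE allE[of _ 1]) auto
  define K where "K = 1 + (\<Sum>i\<in>{1..n}. norm (a i))"
  have "cmod (F w - F z) \<le> K * (\<Sum>i\<in>{1..n}. cmod (w i - z i))"
    if w: "w \<in> U" "(\<Sum>i\<in>{1..n}. cmod (w i - z i)) < \<eta>" for w
  proof -
    let ?s = "\<Sum>i\<in>{1..n}. cmod (w i - z i)"
    have L: "L2_set (\<lambda>i. cmod (w i - z i)) {1..n} \<le> ?s" by (rule L2_set_le_sum) auto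
    have 1: "cmod (F w - F z - (\<Sum>i\<in>{1..n}. a i * (w i - z i))) \<le> ?s"
      using \<eta>(2)[OF w(1)] L w(2) by linarith
    have "cmod (\<Sum>i\<in>{1..n}. a i * (w i - z i)) \<le> (\<Sum>i\<in>{1..n}. norm (a i) * ?s)"
    proof (rule sum_norm_le)
      fix i assume "i \<in> {1..n}"
      then have "cmod (w i - z i) \<le> ?s" by (intro member_le_sum) auto
      then show "cmod (a i * (w i - z i)) \<le> norm (a i) * ?s" by (simp add: norm_mult mult_left_mono)
    qed
    then have 2: "cmod (\<Sum>i\<in>{1..n}. a i * (w i - z i)) \<le> (\<Sum>i\<in>{1..n}. norm (a i)) * ?s"
      by (simp add: sum_distrib_right)
    show ?thesis using norm_triangle_mono[OF 1 2] by (simp add: K_def distrib_right)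
  qed
  moreover have "0 \<le> K" unfolding K_def by (simp add: sum_nonneg)
  ultimately show ?thesis using \<eta>(1) by blast
qed

text \<open>The closeness constant is \<open>M * q / 4\<close> times the \<open>\<theta>\<close>
  defined below; \<open>4 / (M * q)\<close> is the factor lost on passing from marginals to their
  quotients.\<close>

locale holomorphic_density =
  fixes d :: nat and \<delta> :: "nat \<Rightarrow> real" and M L :: real
    and f :: "(nat \<Rightarrow> real) \<Rightarrow> real" and F :: "(nat \<Rightarrow> complex) \<Rightarrow> complex"
  assumes \<delta>_pos: "\<And>j. j \<in> {1..d} \<Longrightarrow> 0 < \<delta> j"
    and M_pos: "0 < M" and M_le_L: "M \<le> L"
    and admissible: "admissible_density d \<delta> M L (M * (M / L) ^ 6 / 512) f F"
begin

definition q where "q = M / L"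

lemma L_pos: "0 < L" and q_pos: "0 < q" and q_le_1: "q \<le> 1"
  using M_pos M_le_L by (auto simp: q_def)

lemma density: "prob_density d f"
  and F_holomorphic: "holomorphic_nvar d F (poly_nbhd d \<delta> cinterval)"
  and F_real: "x \<in> cube d \<Longrightarrow> F (embed d x) = of_real (f x)"
  and F_ge: "z \<in> poly_nbhd d \<delta> cinterval \<Longrightarrow> M \<le> cmod (F z)"
  and F_le: "z \<in> poly_nbhd d \<delta> cinterval \<Longrightarrow> cmod (F z) \<le> L"
  and F_close: "x \<in> cube d \<Longrightarrow> y \<in> poly_nbhd d \<delta> {0} \<Longrightarrow>
        cmod (F (\<lambda>i\<in>{1..d}. embed d x i + y i) - F (embed d x)) \<le> M * q ^ 6 / 512"
  and F_close_front: "x \<in> cube d \<Longrightarrow> k \<in> {1..d-1} \<Longrightarrow>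
        y \<in> PiE {1..d} (\<lambda>i. if i \<le> k then nbhd (\<delta> i) {0} else {0}) \<Longrightarrow>
        cmod (F (\<lambda>i\<in>{1..d}. embed d x i + y i) - F (embed d x)) \<le> M * q ^ 6 / 512 * \<delta> (k + 1)"
  using admissible unfolding admissible_density_def holomorphic_extension_def q_def by blast+

text \<open>Complex in the first \<open>k\<close> coordinates and real in those that are integrated
  out; restricting to \<open>{1..d}\<close> puts the vector into the extensional domain on which
  \<open>F\<close> is controlled.\<close>

definition glue :: "nat \<Rightarrow> (nat \<Rightarrow> complex) \<Rightarrow> (nat \<Rightarrow> real) \<Rightarrow> nat \<Rightarrow> complex" where
  "glue k z t = (\<lambda>i\<in>{1..d}. if i \<le> k then z i else of_real (t i))"

abbreviation tail :: "nat \<Rightarrow> (nat \<Rightarrow> real) measure" where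
  "tail k \<equiv> PiM {k+1..d} (\<lambda>_. half_lebesgue)"

lemma tail_component: "t \<in> space (tail k) \<Longrightarrow> i \<in> {k+1..d} \<Longrightarrow> t i \<in> {-1..1}"
  by (auto simp: space_PiM PiE_iff)

lemma glue_in_nbhd:
  assumes "z \<in> poly_dom k \<delta>" "\<And>i. i \<in> {k+1..d} \<Longrightarrow> t i \<in> {-1..1}"
  shows "glue k z t \<in> poly_nbhd d \<delta> cinterval"
proof -
  have "t i \<in> {-1..1}" if "i \<in> {1..d}" "\<not> i \<le> k" for i using assms(2) that by auto
  then show ?thesis
    using assms(1) \<delta>_pos unfolding poly_nbhd_def poly_dom_def glue_def
    by (auto simp: PiE_iff intro!: of_real_in_nbhd)
qed

lemmas glue_tail_in_nbhd = glue_in_nbhd[OF _ tail_component]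

text \<open>Measurability of this slice of \<open>F\<close> is derived from its continuity in the
  product topology on real tails, which in turn comes from holomorphy.\<close>

lemma measurable_F_glue:
  assumes z: "z \<in> poly_dom k \<delta>"
  shows "(\<lambda>t. F (glue k z t)) \<in> borel_measurable (tail k)"
proof -
  define A where "A = {t :: nat \<Rightarrow> real. \<forall>i\<in>{k+1..d}. t i \<in> {-1..1}}"
  have gA: "glue k z t \<in> poly_nbhd d \<delta> cinterval" if "t \<in> A" for t
    using that by (intro glue_in_nbhd z) (auto simp: A_def)
  have cont: "continuous_on A (\<lambda>t. F (glue k z t))"
    unfolding continuous_on_def
  proof
    fix t assume t: "t \<in> A"
    define s where "s u = (\<Sum>i\<in>{1..d}. cmod (glue k z u i - glue k z t i))" for u
    obtain K \<eta> where K: "0 < \<eta>" "0 \<le> K" "\<And>u. u \<in> A \<Longrightarrow> s u < \<eta> \<Longrightarrow> cmod (F (glue k z u) - F (glue k z t)) \<le> K * s u"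
      using holomorphic_nvar_imp_lipschitz[OF F_holomorphic gA[OF t]] gA unfolding s_def by meson
    have coord: "((\<lambda>u. u i) \<longlongrightarrow> t i) (at t within A)" for i :: nat
      using continuous_on_product_coordinates[of i, THEN continuous_on_subset, of A] t
      by (auto simp: continuous_on_def)
    have "((\<lambda>u. glue k z u i) \<longlongrightarrow> glue k z t i) (at t within A)" if "i \<in> {1..d}" for i
      using that coord[of i] by (cases "i \<le> k") (auto simp: glue_def intro!: tendsto_intros)
    then have "(s \<longlongrightarrow> (\<Sum>i\<in>{1..d}. cmod (glue k z t i - glue k z t i))) (at t within A)"
      unfolding s_def by (intro tendsto_intros)
    then have s0: "(s \<longlongrightarrow> 0) (at t within A)" by simp
    have "((\<lambda>u. F (glue k z u) - F (glue k z t)) \<longlongrightarrow> 0) (at t within A)"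
    proof (rule Lim_null_comparison)
      have "\<forall>\<^sub>F u in at t within A. s u < \<eta>" using s0 K(1) by (rule order_tendstoD)
      moreover have "\<forall>\<^sub>F u in at t within A. u \<in> A" by (simp add: eventually_at_filter)
      ultimately show "\<forall>\<^sub>F u in at t within A. norm (F (glue k z u) - F (glue k z t)) \<le> K * s u"
        by eventually_elim (rule K(3))
      show "((\<lambda>u. K * s u) \<longlongrightarrow> 0) (at t within A)"
        using tendsto_mult[OF tendsto_const[of K] s0] by simp
    qed
    then show "((\<lambda>t. F (glue k z t)) \<longlongrightarrow> F (glue k z t)) (at t within A)"
      by (simp add: LIM_zero_iff)
  qed
  \<comment> \<open>Points of \<open>tail k\<close> are undefined outside \<open>{k+1..d}\<close>.
    Setting those coordinates to 0 maps them measurably into the full product, whose product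
    sigma-algebra is the Borel one; \<open>glue k z\<close> does not see the change.\<close>
  define ext0 where "ext0 t = (\<lambda>i. if i \<in> {k+1..d} then t i else 0)" for t :: "nat \<Rightarrow> real"
  have "ext0 \<in> measurable (tail k) (PiM UNIV (\<lambda>_. borel))"
    unfolding ext0_def
  proof (rule measurable_PiM_single')
    fix i :: nat
    show "(\<lambda>t. if i \<in> {k+1..d} then t i else 0) \<in> borel_measurable (tail k)"
    proof (cases "i \<in> {k+1..d}")
      case True
      then have "(\<lambda>t. t i) \<in> measurable (tail k) half_lebesgue" by (rule measurable_component_singleton)
      from measurable_compose[OF this measurable_half_lebesgue_id] show ?thesis using True by simp
    next
      case False
      then show ?thesis by (simp only: if_False) simp
    qed
  qed (auto simp: space_PiM)
  then have "ext0 \<in> measurable (tail k) borel"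
    by (simp add: measurable_cong_sets[OF refl sets_PiM_equal_borel])
  then have "ext0 \<in> measurable (tail k) (restrict_space borel A)"
    by (intro measurable_restrict_space2) (auto simp: A_def ext0_def space_PiM PiE_iff)
  from measurable_compose[OF this borel_measurable_continuous_on_restrict[OF cont]]
  have "(\<lambda>t. F (glue k z (ext0 t))) \<in> borel_measurable (tail k)" .
  moreover have "glue k z (ext0 t) = glue k z t" for t
    by (auto simp: glue_def ext0_def restrict_def fun_eq_iff)
  ultimately show ?thesis by simp
qed

definition P :: "nat \<Rightarrow> (nat \<Rightarrow> complex) \<Rightarrow> complex" where
  "P k z = (\<integral>t. F (glue k z t) \<partial>tail k)"

lemma P_cong: "(\<And>i. i \<in> {1..k} \<Longrightarrow> z i = w i) \<Longrightarrow> P k z = P k w"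
  unfolding P_def glue_def by (intro Bochner_Integration.integral_cong arg_cong[of _ _ F]) (auto simp: restrict_def fun_eq_iff)

lemma integrable_F_glue: "z \<in> poly_dom k \<delta> \<Longrightarrow> integrable (tail k) (\<lambda>t. F (glue k z t))"
  by (rule prob_space.integrable_bounded(1)[OF prob_space_PiM_half_lebesgue measurable_F_glue, of _ _ L])
    (auto intro!: F_le glue_tail_in_nbhd)

lemma norm_P_le: "z \<in> poly_dom k \<delta> \<Longrightarrow> cmod (P k z) \<le> L"
  unfolding P_def
  by (rule prob_space.integrable_bounded(2)[OF prob_space_PiM_half_lebesgue measurable_F_glue])
    (auto intro!: F_le glue_tail_in_nbhd)

lemma curve_holomorphic_P: "curve_holomorphic (P k) (poly_dom k \<delta>)"
  unfolding curve_holomorphic_def P_def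
proof (intro allI impI)
  fix \<gamma> :: "complex \<Rightarrow> nat \<Rightarrow> complex" and W :: "complex set"
  assume W: "open W" and hol: "\<forall>i. (\<lambda>l. \<gamma> l i) holomorphic_on W" and U: "\<forall>l\<in>W. \<gamma> l \<in> poly_dom k \<delta>"
  interpret prob_space "tail k" by (rule prob_space_PiM_half_lebesgue)
  show "(\<lambda>l. \<integral>t. F (glue k (\<gamma> l) t) \<partial>tail k) holomorphic_on W"
  proof (rule holomorphic_on_integral[OF W])
    fix t assume t: "t \<in> space (tail k)"
    show "(\<lambda>l. F (glue k (\<gamma> l) t)) holomorphic_on W"
    proof (rule curve_holomorphicD[OF holomorphic_nvar_imp_curve[OF F_holomorphic] W, where \<gamma> = "\<lambda>l. glue k (\<gamma> l) t"])
      show "(\<lambda>l. glue k (\<gamma> l) t i) holomorphic_on W" for i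
        using hol by (cases "i \<in> {1..d}"; cases "i \<le> k") (auto simp: glue_def)
    qed (use U t in \<open>auto intro!: glue_tail_in_nbhd\<close>)
  next
    fix l t assume "l \<in> W" "t \<in> space (tail k)"
    then show "norm (F (glue k (\<gamma> l) t)) \<le> L"
      using U by (auto intro!: F_le glue_tail_in_nbhd)
  qed (use U measurable_F_glue in blast)
qed

text \<open>Fubini, with coordinate \<open>k\<close> peeled off the tail. The identity holds for
  complex \<open>z\<close>, which is why the complexified conditionals keep mean 1.\<close>

lemma P_marginalize:
  assumes k: "k \<in> {1..d}" and z: "z \<in> poly_dom (k - 1) \<delta>"
  shows "(\<lambda>s. P k (z(k := complex_of_real s))) \<in> borel_measurable half_lebesgue"
    and "P (k - 1) z = (\<integral>s. P k (z(k := complex_of_real s)) \<partial>half_lebesgue)"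
proof -
  have J: "{k - 1 + 1..d} = {k} \<union> {k+1..d}" using k by auto
  have zk: "z(k := complex_of_real s) \<in> poly_dom k \<delta>" if "s \<in> {-1..1}" for s
    using z that \<delta>_pos k by (auto simp: poly_dom_def intro!: of_real_in_nbhd)
  have "continuous_on {-1..1} (\<lambda>s. P k (z(k := complex_of_real s)))"
  proof -
    have "(\<lambda>s. P k (z(k := s))) holomorphic_on nbhd (\<delta> k) cinterval"
      using z k by (intro curve_holomorphic_line[OF curve_holomorphic_P open_nbhd]) (auto simp: poly_dom_def)
    from continuous_on_compose2[OF holomorphic_on_imp_continuous_on[OF this], of "{-1..1}" complex_of_real]
    show ?thesis using \<delta>_pos k by (auto intro!: continuous_intros of_real_in_nbhd)
  qed
  then show meas: "(\<lambda>s. P k (z(k := complex_of_real s))) \<in> borel_measurable half_lebesgue"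
    by (subst measurable_cong_sets[OF sets_half_lebesgue refl]) (rule borel_measurable_continuous_on_restrict)
  have "P (k - 1) z = (\<integral>x. (\<integral>y. F (glue (k - 1) z (merge {k} {k+1..d} (x, y))) \<partial>tail k) \<partial>PiM {k} (\<lambda>_. half_lebesgue))"
    unfolding P_def J
    by (rule hl.product_integral_fold) (use integrable_F_glue[OF z, unfolded J] in auto)
  also have "\<dots> = (\<integral>x. P k (z(k := complex_of_real (x k))) \<partial>PiM {k} (\<lambda>_. half_lebesgue))"
    unfolding P_def
  proof (intro Bochner_Integration.integral_cong refl arg_cong[of _ _ F])
    fix x y :: "nat \<Rightarrow> real"
    show "glue (k - 1) z (merge {k} {k+1..d} (x, y)) = glue k (z(k := complex_of_real (x k))) y"
      using k by (auto simp: glue_def restrict_def fun_eq_iff merge_def)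
  qed
  also have "\<dots> = (\<integral>s. P k (z(k := complex_of_real s)) \<partial>half_lebesgue)"
    using meas by (rule hl.product_integral_singleton)
  finally show "P (k - 1) z = (\<integral>s. P k (z(k := complex_of_real s)) \<partial>half_lebesgue)" .
qed

section \<open>Values at real points\<close>

lemma f_bounds: "x \<in> cube d \<Longrightarrow> M \<le> f x" "x \<in> cube d \<Longrightarrow> f x \<le> L"
proof -
  assume x: "x \<in> cube d"
  have "embed d x \<in> poly_nbhd d \<delta> cinterval"
    using x \<delta>_pos by (auto simp: embed_def poly_nbhd_def cube_def PiE_iff intro!: of_real_in_nbhd)
  moreover have "0 < f x" using density x by (simp add: prob_density_def)
  ultimately show "M \<le> f x" "f x \<le> L" using F_ge[of "embed d x"] F_le[of "embed d x"] F_real[OF x] by auto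
qed

definition glue_real :: "nat \<Rightarrow> (nat \<Rightarrow> real) \<Rightarrow> (nat \<Rightarrow> real) \<Rightarrow> nat \<Rightarrow> real" where
  "glue_real k x t = (\<lambda>i\<in>{1..d}. if i \<le> k then x i else t i)"

lemma embed_glue_real: "embed d (glue_real k x t) = glue k (\<lambda>i. of_real (x i)) t"
  by (auto simp: embed_def glue_real_def glue_def)

lemma glue_real_in_cube:
  assumes "\<And>i. i \<in> {1..k} \<Longrightarrow> x i \<in> {-1..1}" "t \<in> space (tail k)"
  shows "glue_real k x t \<in> cube d"
proof -
  have "t i \<in> {-1..1}" if "i \<in> {1..d}" "\<not> i \<le> k" for i
    using tail_component[OF assms(2), of i] that by auto
  then show ?thesis using assms(1) by (auto simp: glue_real_def cube_def PiE_iff)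
qed

lemma real_in_dom:
  assumes "k \<le> d" "\<And>i. i \<in> {1..k} \<Longrightarrow> x i \<in> {-1..1}"
  shows "(\<lambda>i. complex_of_real (x i)) \<in> poly_dom k \<delta>"
  using assms \<delta>_pos by (auto simp: poly_dom_def intro!: of_real_in_nbhd)

lemma P_real:
  assumes k: "k \<le> d" and x: "\<And>i. i \<in> {1..k} \<Longrightarrow> x i \<in> {-1..1}"
  obtains p where "P k (\<lambda>i. of_real (x i)) = of_real p" "p = (\<integral>t. f (glue_real k x t) \<partial>tail k)" "M \<le> p" "p \<le> L"
proof -
  define p where "p = (\<integral>t. f (glue_real k x t) \<partial>tail k)"
  interpret prob_space "tail k" by (rule prob_space_PiM_half_lebesgue)
  have eq: "F (glue k (\<lambda>i. of_real (x i)) t) = of_real (f (glue_real k x t))" if "t \<in> space (tail k)" for t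
    using F_real[OF glue_real_in_cube[OF x that]] by (simp add: embed_glue_real)
  have int: "integrable (tail k) (\<lambda>t. complex_of_real (f (glue_real k x t)))"
    by (rule Bochner_Integration.integrable_cong[OF refl eq, THEN iffD1], assumption)
      (intro integrable_F_glue real_in_dom k x)
  then have int': "integrable (tail k) (\<lambda>t. f (glue_real k x t))" by (simp only: complex_of_real_integrable_eq)
  have "P k (\<lambda>i. of_real (x i)) = of_real p"
    unfolding P_def p_def using eq by (simp cong: Bochner_Integration.integral_cong)
  moreover have "M \<le> p" unfolding p_def
    using int' f_bounds(1) glue_real_in_cube[OF x] by (intro integral_ge_const) auto
  moreover have "p \<le> L" unfolding p_def
    using int' f_bounds(2) glue_real_in_cube[OF x] by (intro integral_le_const) auto
  ultimately show ?thesis using that p_def by blast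
qed

text \<open>Here the normalisation of \<open>f\<close> enters: \<open>marginal\<close> is 1 at level
  0 by convention, whereas \<open>P 0\<close> is the total integral, and the first conditional needs
  the two to agree.\<close>

lemma P_0: "P 0 z = 1"
proof -
  have "P 0 z = (\<integral>t. complex_of_real (f t) \<partial>cube_measure d)"
    unfolding P_def cube_measure_def
  proof (rule Bochner_Integration.integral_cong)
    fix t assume "t \<in> space (PiM {1..d} (\<lambda>_. half_lebesgue))"
    then have "t \<in> cube d" by (simp add: cube_def space_PiM)
    moreover have "embed d t = glue 0 z t" by (auto simp: embed_def glue_def)
    ultimately show "F (glue 0 z t) = complex_of_real (f t)" using F_real by metis
  qed simp
  also have "\<dots> = of_real (\<integral>t. f t \<partial>cube_measure d)" by simp
  also have "(\<integral>t. f t \<partial>cube_measure d) = 1"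
    using density by (auto simp: prob_density_def has_bochner_integral_iff)
  finally show ?thesis by simp
qed

lemma P_eq_marginal:
  assumes k: "k \<le> d" and x: "\<And>i. i \<in> {1..k} \<Longrightarrow> x i \<in> {-1..1}"
  shows "P k (\<lambda>i. of_real (x i)) = of_real (marginal d f k x)"
proof (cases "k = 0")
  case True
  then show ?thesis by (simp add: P_0 marginal_def)
next
  case False
  obtain p where p: "P k (\<lambda>i. of_real (x i)) = of_real p" "p = (\<integral>t. f (glue_real k x t) \<partial>tail k)"
    using P_real[OF k, of x, OF x] by metis
  have "p = marginal d f k x" unfolding p(2) marginal_def using False
    by (auto simp: glue_real_def merge_def restrict_def fun_eq_iff intro!: Bochner_Integration.integral_cong arg_cong[of _ _ f]) (use k in auto)
  with p show ?thesis by simp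
qed

text \<open>A bound uniform over the tail survives averaging because \<open>tail k\<close> is a
  probability measure; this is where the number of integrated coordinates drops out.\<close>

lemma P_diff_le:
  assumes k: "k \<le> d" and z: "z \<in> poly_dom k \<delta>" and x: "\<And>i. i \<in> {1..k} \<Longrightarrow> x i \<in> {-1..1}"
    and D: "\<And>t. t \<in> space (tail k) \<Longrightarrow> cmod (F (glue k z t) - F (glue k (\<lambda>i. of_real (x i)) t)) \<le> D"
  shows "cmod (P k z - P k (\<lambda>i. of_real (x i))) \<le> D"
proof -
  have "P k z - P k (\<lambda>i. of_real (x i)) = (\<integral>t. F (glue k z t) - F (glue k (\<lambda>i. of_real (x i)) t) \<partial>tail k)"
    unfolding P_def
    using integrable_F_glue[OF z] integrable_F_glue[OF real_in_dom[OF k x]]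
    by (intro Bochner_Integration.integral_diff[symmetric])
  also have "cmod \<dots> \<le> D"
    using measurable_F_glue[OF z] measurable_F_glue[OF real_in_dom[OF k x]] D
    by (intro prob_space.integrable_bounded(2)[OF prob_space_PiM_half_lebesgue]) auto
  finally show ?thesis .
qed

lemma near_real_in_dom:
  "(\<And>i. i \<in> {1..k} \<Longrightarrow> x i \<in> {-1..1}) \<Longrightarrow> (\<And>i. i \<in> {1..k} \<Longrightarrow> cmod (z i - of_real (x i)) < \<delta> i) \<Longrightarrow> z \<in> poly_dom k \<delta>"
  unfolding poly_dom_def using nbhd_cintervalI by blast

text \<open>The form in which hypotheses (c) and (d) speak: a real point plus a perturbation, here
  supported on the first \<open>k\<close> coordinates.\<close>

lemma glue_perturb:
  "glue k z t = (\<lambda>i\<in>{1..d}. embed d (glue_real k x t) i + (\<lambda>i\<in>{1..d}. if i \<le> k then z i - of_real (x i) else 0) i)"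
  by (auto simp: glue_def glue_real_def embed_def)

lemma P_close:
  assumes k: "k \<le> d" and x: "\<And>i. i \<in> {1..k} \<Longrightarrow> x i \<in> {-1..1}"
    and z: "\<And>i. i \<in> {1..k} \<Longrightarrow> cmod (z i - of_real (x i)) < \<delta> i"
  shows "cmod (P k z - P k (\<lambda>i. of_real (x i))) \<le> M * q ^ 6 / 512"
proof (rule P_diff_le[OF k near_real_in_dom[OF x z] x])
  fix t assume t: "t \<in> space (tail k)"
  have "(\<lambda>i\<in>{1..d}. if i \<le> k then z i - of_real (x i) else 0) \<in> poly_nbhd d \<delta> {0}"
    using z \<delta>_pos by (auto simp: poly_nbhd_def nbhd_def)
  from F_close[OF glue_real_in_cube[OF x t] this]
  show "cmod (F (glue k z t) - F (glue k (\<lambda>i. of_real (x i)) t)) \<le> M * q ^ 6 / 512"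
    unfolding glue_perturb[of k z t x] by (simp add: embed_glue_real)
qed

text \<open>Two levels matter: \<open>k = j\<close>, with every coordinate perturbed, and
  \<open>k = j + 1\<close>, with the last one real. Both marginals of a conditional thus obey the
  same bound.\<close>

lemma P_close_front:
  assumes k: "k \<le> d" and j: "1 \<le> j" "j < d" and x: "\<And>i. i \<in> {1..k} \<Longrightarrow> x i \<in> {-1..1}"
    and z: "\<And>i. i \<in> {1..k} \<Longrightarrow> cmod (z i - of_real (x i)) < \<delta> i"
    and eq: "\<And>i. i \<in> {j+1..k} \<Longrightarrow> z i = of_real (x i)"
  shows "cmod (P k z - P k (\<lambda>i. of_real (x i))) \<le> M * q ^ 6 / 512 * \<delta> (j + 1)"
proof (rule P_diff_le[OF k near_real_in_dom[OF x z] x])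
  fix t assume t: "t \<in> space (tail k)"
  have "(\<lambda>i\<in>{1..d}. if i \<le> k then z i - of_real (x i) else 0)
      \<in> PiE {1..d} (\<lambda>i. if i \<le> j then nbhd (\<delta> i) {0} else {0})"
    using z eq \<delta>_pos by (auto simp: nbhd_def)
  from F_close_front[OF glue_real_in_cube[OF x t] _ this]
  show "cmod (F (glue k z t) - F (glue k (\<lambda>i. of_real (x i)) t)) \<le> M * q ^ 6 / 512 * \<delta> (j + 1)"
    unfolding glue_perturb[of k z t x] using j by (simp add: embed_glue_real)
qed

end

subsection \<open>Conditional densities and distribution functions\<close>

lemma poly_dom_mono: "z \<in> poly_dom k r \<Longrightarrow> j \<le> k \<Longrightarrow> z \<in> poly_dom j r"
  by (auto simp: poly_dom_def)

lemma poly_dom_realE: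
  assumes "z \<in> poly_dom k r"
  obtains x :: "nat \<Rightarrow> real" where "\<And>i. i \<in> {1..k} \<Longrightarrow> x i \<in> {-1..1}"
    "\<And>i. i \<in> {1..k} \<Longrightarrow> cmod (z i - of_real (x i)) < r i"
proof -
  have "\<forall>i\<in>{1..k}. \<exists>x. x \<in> {-1..1} \<and> cmod (z i - complex_of_real x) < r i"
    using assms unfolding poly_dom_def by (blast elim: nbhd_cintervalE)
  from bchoice[OF this] that show ?thesis by metis
qed

lemma minus_one_in_nbhd: "0 < r \<Longrightarrow> - 1 \<in> nbhd r cinterval"
  using of_real_in_nbhd[of "-1" r] by simp

context holomorphic_density
begin

definition cnd :: "nat \<Rightarrow> (nat \<Rightarrow> complex) \<Rightarrow> complex" where
  "cnd k z = P k z / P (k - 1) z"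

text \<open>The fifth power is what the quotient of two conditionals requires: its error is at most
  \<open>4 * \<theta> / q ^ 3 = q ^ 2 / 32\<close>.\<close>

definition \<theta> where "\<theta> = q ^ 5 / 128"

lemma \<theta>_pos: "0 < \<theta>" and \<theta>_le: "\<theta> \<le> q / 128"
proof -
  show "0 < \<theta>" using q_pos by (simp add: \<theta>_def)
  have "q ^ 5 \<le> q ^ 1" using q_pos q_le_1 by (intro power_decreasing) auto
  then show "\<theta> \<le> q / 128" by (simp add: \<theta>_def)
qed

lemma norm_P_ge:
  assumes k: "k \<le> d" and z: "z \<in> poly_dom k \<delta>"
  shows "M / 2 \<le> cmod (P k z)"
proof -
  obtain x where x: "\<And>i. i \<in> {1..k} \<Longrightarrow> x i \<in> {-1..1}"
    "\<And>i. i \<in> {1..k} \<Longrightarrow> cmod (z i - of_real (x i)) < \<delta> i"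
    using poly_dom_realE[OF z] by blast
  obtain p where p: "P k (\<lambda>i. of_real (x i)) = of_real p" "M \<le> p"
    using P_real[of k x, OF k x(1)] by blast
  have "cmod (P k z - of_real p) \<le> M * q ^ 6 / 512"
    using P_close[of k x z, OF k x] p(1) by simp
  moreover have "M * q ^ 6 \<le> M * 1"
    using M_pos q_pos q_le_1 by (intro mult_left_mono power_le_one) auto
  moreover have "cmod (of_real p) \<le> cmod (P k z) + cmod (P k z - of_real p)"
    by (metis norm_minus_commute norm_triangle_sub)
  moreover have "cmod (of_real p) = p" using p(2) M_pos by simp
  ultimately show ?thesis using p(2) M_pos by linarith
qed

lemma P_nonzero: "k \<le> d \<Longrightarrow> z \<in> poly_dom k \<delta> \<Longrightarrow> P k z \<noteq> 0"
  using norm_P_ge[of k z] M_pos by auto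

lemma cnd_cong: "1 \<le> k \<Longrightarrow> (\<And>i. i \<in> {1..k} \<Longrightarrow> z i = w i) \<Longrightarrow> cnd k z = cnd k w"
  unfolding cnd_def by (intro arg_cong2[of _ _ _ _ "(/)"] P_cong) auto

lemma curve_holomorphic_cnd: "k \<le> d \<Longrightarrow> curve_holomorphic (cnd k) (poly_dom k \<delta>)"
  unfolding cnd_def
  by (intro curve_holomorphic_divide curve_holomorphic_P curve_holomorphic_subset[OF curve_holomorphic_P] P_nonzero)
    (auto intro: poly_dom_mono)

lemma cnd_real:
  assumes k: "k \<in> {1..d}" and x: "\<And>i. i \<in> {1..k} \<Longrightarrow> x i \<in> {-1..1}"
  shows "cnd k (\<lambda>i. of_real (x i)) = of_real (conditional d f k x)"
    and "q \<le> conditional d f k x" "conditional d f k x \<le> 1 / q"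
proof -
  have x': "\<And>i. i \<in> {1..k-1} \<Longrightarrow> x i \<in> {-1..1}" using x by auto
  have k': "k \<le> d" "k - 1 \<le> d" using k by auto
  obtain p where p: "P k (\<lambda>i. of_real (x i)) = of_real p" "M \<le> p" "p \<le> L"
    using P_real[of k x, OF k'(1) x] by blast
  obtain r where r: "P (k-1) (\<lambda>i. of_real (x i)) = of_real r" "M \<le> r" "r \<le> L"
    using P_real[of "k-1" x, OF k'(2) x'] by blast
  have "marginal d f k x = p" "marginal d f (k-1) x = r"
    using P_eq_marginal[of k x, OF k'(1) x] P_eq_marginal[of "k-1" x, OF k'(2) x'] p(1) r(1) by simp_all
  then have c: "conditional d f k x = p / r" by (simp add: conditional_def)
  then show "cnd k (\<lambda>i. of_real (x i)) = of_real (conditional d f k x)"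
    unfolding cnd_def p(1) r(1) by simp
  show "q \<le> conditional d f k x" "conditional d f k x \<le> 1 / q"
    unfolding c q_def using p r M_pos by (auto intro!: frac_le)
qed

text \<open>The factor \<open>t\<close> is 1 under hypothesis (c) and \<open>\<delta> k\<close>
  under (d), so both cases share one estimate. With a marginal error \<open>E\<close>, the numerator
  of the difference of quotients is at most \<open>2 * L * E\<close> and the denominator at least
  \<open>M / 2 * M\<close>.\<close>

lemma cnd_diff_le:
  assumes k: "k \<in> {1..d}" and x: "\<And>i. i \<in> {1..k} \<Longrightarrow> x i \<in> {-1..1}"
    and z: "z \<in> poly_dom k \<delta>"
    and D: "cmod (P k z - P k (\<lambda>i. of_real (x i))) \<le> M * q ^ 6 / 512 * t"
      "cmod (P (k - 1) z - P (k - 1) (\<lambda>i. of_real (x i))) \<le> M * q ^ 6 / 512 * t"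
  shows "cmod (cnd k z - cnd k (\<lambda>i. of_real (x i))) \<le> \<theta> * t"
proof -
  have x': "\<And>i. i \<in> {1..k-1} \<Longrightarrow> x i \<in> {-1..1}" using x by auto
  have k': "k \<le> d" "k - 1 \<le> d" using k by auto
  obtain p where p: "P k (\<lambda>i. of_real (x i)) = of_real p" "M \<le> p" "p \<le> L"
    using P_real[of k x, OF k'(1) x] by blast
  obtain r where r: "P (k-1) (\<lambda>i. of_real (x i)) = of_real r" "M \<le> r" "r \<le> L"
    using P_real[of "k-1" x, OF k'(2) x'] by blast
  define a b where "a = P k z" and "b = P (k - 1) z"
  define E where "E = M * q ^ 6 / 512 * t"
  have b: "M / 2 \<le> cmod b" unfolding b_def using z k' by (intro norm_P_ge) (auto intro: poly_dom_mono)
  have D': "cmod (a - of_real p) \<le> E" "cmod (b - of_real r) \<le> E"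
    using D unfolding a_def b_def p(1) r(1) E_def .
  have E0: "0 \<le> E" using D'(1) norm_ge_zero order_trans by blast
  have nz: "b \<noteq> 0" "r \<noteq> 0" using b r M_pos by auto
  have "a / b - of_real p / of_real r = ((a - of_real p) * of_real r - of_real p * (b - of_real r)) / (b * of_real r)"
    using nz by (simp add: field_simps)
  also have "cmod \<dots> = cmod ((a - of_real p) * of_real r - of_real p * (b - of_real r)) / (cmod b * r)"
    using r M_pos by (simp add: norm_divide norm_mult)
  also have "\<dots> \<le> (2 * L * E) / ((M / 2) * M)"
  proof (rule frac_le)
    have "cmod ((a - of_real p) * of_real r - of_real p * (b - of_real r)) \<le> cmod (a - of_real p) * r + p * cmod (b - of_real r)"
      using r p M_pos norm_triangle_ineq4[of "(a - of_real p) * of_real r" "of_real p * (b - of_real r)"] by (simp add: norm_mult)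
    also have "\<dots> \<le> E * L + L * E" using D' r p M_pos L_pos E0 by (intro add_mono mult_mono) auto
    finally show "cmod ((a - of_real p) * of_real r - of_real p * (b - of_real r)) \<le> 2 * L * E" by (simp add: mult_ac)
    show "(M / 2) * M \<le> cmod b * r" using b r M_pos by (intro mult_mono) auto
  qed (use M_pos L_pos E0 in auto)
  also have "\<dots> = \<theta> * t"
    using M_pos L_pos by (simp add: E_def \<theta>_def q_def field_simps power_numeral_reduce)
  finally show ?thesis unfolding cnd_def a_def b_def p(1) r(1) .
qed

lemma cnd_close:
  assumes k: "k \<in> {1..d}" and x: "\<And>i. i \<in> {1..k} \<Longrightarrow> x i \<in> {-1..1}"
    and z: "\<And>i. i \<in> {1..k} \<Longrightarrow> cmod (z i - of_real (x i)) < \<delta> i"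
  shows "cmod (cnd k z - cnd k (\<lambda>i. of_real (x i))) \<le> \<theta>"
proof -
  have "cmod (P j z - P j (\<lambda>i. of_real (x i))) \<le> M * q ^ 6 / 512 * 1" if "j \<in> {k-1,k}" for j
    using that k x z by (subst mult_1_right, intro P_close) auto
  from cnd_diff_le[OF k x near_real_in_dom[of k x z, OF x z] this this] show ?thesis by simp
qed

text \<open>With a real last coordinate the perturbed block has length \<open>k - 1\<close>, so
  hypothesis (d) supplies the factor \<open>\<delta> k\<close> for numerator and denominator
  alike.\<close>

lemma cnd_close_last:
  assumes k: "k \<in> {1..d}" and x: "\<And>i. i \<in> {1..k} \<Longrightarrow> x i \<in> {-1..1}"
    and z: "\<And>i. i \<in> {1..k-1} \<Longrightarrow> cmod (z i - of_real (x i)) < \<delta> i" and zk: "z k = of_real (x k)"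
  shows "cmod (cnd k z - cnd k (\<lambda>i. of_real (x i))) \<le> \<theta> * \<delta> k"
proof -
  have z': "cmod (z i - of_real (x i)) < \<delta> i" if "i \<in> {1..k}" for i
    using z[of i] zk \<delta>_pos[of k] k that by (cases "i = k") auto
  show ?thesis
  proof (cases "k = 1")
    case True
    \<comment> \<open>Blocks in hypothesis (d) have length at least 1; for \<open>k = 1\<close> no
      coordinate is perturbed at all.\<close>
    then have "cnd k z = cnd k (\<lambda>i. of_real (x i))" using zk by (intro cnd_cong) auto
    then show ?thesis using \<theta>_pos \<delta>_pos[of k] k by simp
  next
    case False
    have "cmod (P j z - P j (\<lambda>i. of_real (x i))) \<le> M * q ^ 6 / 512 * \<delta> (k - 1 + 1)" if "j \<in> {k-1,k}" for j
    proof (rule P_close_front)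
      \<comment> \<open>The range is empty for \<open>j = k - 1\<close> and is \<open>{k}\<close>
        for \<open>j = k\<close>.\<close>
      show "z i = of_real (x i)" if "i \<in> {k - 1 + 1..j}" for i
        using that \<open>j \<in> {k-1,k}\<close> zk by (cases "i = k") auto
    qed (use that k False x z' in auto)
    from cnd_diff_le[OF k x near_real_in_dom[of k x z, OF x z'] this this]
    show ?thesis using k by simp
  qed
qed

text \<open>The real part needs comparison with a nearby real value; the modulus follows directly
  from the bounds on the two marginals.\<close>

lemma cnd_bounds:
  assumes k: "k \<in> {1..d}" and z: "z \<in> poly_dom k \<delta>"
  shows "q / 2 \<le> Re (cnd k z)" "cmod (cnd k z) \<le> 2 / q"
proof -
  obtain x where x: "\<And>i. i \<in> {1..k} \<Longrightarrow> x i \<in> {-1..1}"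
    "\<And>i. i \<in> {1..k} \<Longrightarrow> cmod (z i - of_real (x i)) < \<delta> i"
    using poly_dom_realE[OF z] by blast
  have "cmod (cnd k z - of_real (conditional d f k x)) \<le> \<theta>"
    using cnd_close[of k x z, OF k x] cnd_real(1)[of k x, OF k x(1)] by simp
  then have "\<bar>Re (cnd k z) - conditional d f k x\<bar> \<le> \<theta>"
    using abs_Re_le_cmod[of "cnd k z - of_real (conditional d f k x)"] by simp
  then show "q / 2 \<le> Re (cnd k z)"
    using cnd_real(2)[of k x, OF k x(1)] \<theta>_le q_pos by simp
  have "cmod (P k z) / cmod (P (k - 1) z) \<le> L / (M / 2)"
    using z k by (intro frac_le norm_P_le norm_P_ge) (auto simp: L_pos M_pos less_imp_le intro: poly_dom_mono)
  then show "cmod (cnd k z) \<le> 2 / q" by (simp add: cnd_def norm_divide q_def mult.commute)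
qed

lemma cnd_nonzero: "k \<in> {1..d} \<Longrightarrow> z \<in> poly_dom k \<delta> \<Longrightarrow> cnd k z \<noteq> 0"
  using cnd_bounds(1)[of k z] q_pos by auto

text \<open>Complexification of \<open>cond_cdf\<close>. The straight path stays in the convex
  neighbourhood of the interval, so \<open>H\<close> is the primitive of the conditional in its last
  variable that vanishes at -1.\<close>

definition H :: "nat \<Rightarrow> (nat \<Rightarrow> complex) \<Rightarrow> complex" where
  "H k z = contour_integral (linepath (-1) (z k)) (\<lambda>s. cnd k (z(k := s)))"

lemma H_cong: "1 \<le> k \<Longrightarrow> (\<And>i. i \<in> {1..k} \<Longrightarrow> z i = w i) \<Longrightarrow> H k z = H k w"
  unfolding H_def by (intro contour_integral_cong cnd_cong) auto

lemma upd_in_dom: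
  assumes "z \<in> poly_dom (k - 1) r" "s \<in> nbhd (r k) cinterval"
  shows "z(k := s) \<in> poly_dom k r"
  unfolding poly_dom_def
proof safe
  fix i assume "i \<in> {1..k}"
  then show "(z(k := s)) i \<in> nbhd (r i) cinterval"
    using assms by (cases "i = k") (auto simp: poly_dom_def)
qed

lemma cnd_line_holomorphic:
  assumes k: "k \<in> {1..d}" and z: "z \<in> poly_dom (k - 1) \<delta>"
  shows "(\<lambda>s. cnd k (z(k := s))) holomorphic_on nbhd (\<delta> k) cinterval"
  using k by (intro curve_holomorphic_line[OF curve_holomorphic_cnd open_nbhd] upd_in_dom z) auto

lemma H_start: "H k (z(k := -1)) = 0"
  by (simp add: H_def)

lemma H_deriv:
  assumes k: "k \<in> {1..d}" and z: "z \<in> poly_dom (k - 1) \<delta>" and s: "s \<in> nbhd (\<delta> k) cinterval"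
  shows "((\<lambda>s. H k (z(k := s))) has_field_derivative cnd k (z(k := s))) (at s)"
proof -
  let ?V = "nbhd (\<delta> k) cinterval"
  obtain g where g: "\<And>s. s \<in> ?V \<Longrightarrow> (g has_field_derivative cnd k (z(k := s))) (at s within ?V)"
    using holomorphic_convex_primitive'[OF convex_nbhd_cinterval open_nbhd cnd_line_holomorphic[OF k z]] by metis
  have "H k (z(k := s)) = g s - g (- 1)" if "s \<in> ?V" for s
  proof -
    have "closed_segment (- 1) s \<subseteq> ?V"
      using that k \<delta>_pos[of k] by (intro closed_segment_subset convex_nbhd_cinterval minus_one_in_nbhd) auto
    then have "((\<lambda>s. cnd k (z(k := s))) has_contour_integral (g (pathfinish (linepath (-1) s)) - g (pathstart (linepath (-1) s)))) (linepath (-1) s)"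
      by (intro contour_integral_primitive[OF g]) auto
    then show ?thesis by (simp add: H_def contour_integral_unique)
  qed
  then have eq: "\<And>s. s \<in> ?V \<Longrightarrow> g s - g (- 1) = H k (z(k := s))" by simp
  have "((\<lambda>s. g s - g (- 1)) has_field_derivative cnd k (z(k := s))) (at s)"
    using g[OF s] at_within_open[OF s open_nbhd] by (auto intro!: derivative_eq_intros)
  from has_field_derivative_transform_within_open[OF this open_nbhd s eq] show ?thesis .
qed

lemma H_upper:
  assumes k: "k \<in> {1..d}" and z: "z \<in> poly_dom (k - 1) \<delta>"
    and s: "s \<in> nbhd (\<delta> k) cinterval" "t \<in> nbhd (\<delta> k) cinterval"
  shows "cmod (H k (z(k := s)) - H k (z(k := t))) \<le> 2 / q * cmod (s - t)"
proof (rule field_differentiable_bound[OF convex_nbhd_cinterval])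
  fix u assume u: "u \<in> nbhd (\<delta> k) cinterval"
  show "((\<lambda>s. H k (z(k := s))) has_field_derivative cnd k (z(k := u))) (at u within nbhd (\<delta> k) cinterval)"
    using H_deriv[OF k z u] by (rule has_field_derivative_at_within)
  show "cmod (cnd k (z(k := u))) \<le> 2 / q" using cnd_bounds(2)[OF k upd_in_dom[OF z u]] .
qed (use s in auto)

lemma segment_in_nbhd:
  "a \<in> nbhd r cinterval \<Longrightarrow> b \<in> nbhd r cinterval \<Longrightarrow> u \<in> closed_segment a b \<Longrightarrow> u \<in> nbhd r cinterval"
  using closed_segment_subset[OF _ _ convex_nbhd_cinterval] by blast

text \<open>The mean slope of \<open>H\<close> between two points has real part at least
  \<open>q / 2\<close>, since the conditional does along the segment. Dividing by
  \<open>s - t\<close> beforehand makes the mean value theorem for real parts speak about this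
  slope.\<close>

lemma H_lower:
  assumes k: "k \<in> {1..d}" and z: "z \<in> poly_dom (k - 1) \<delta>"
    and s: "s \<in> nbhd (\<delta> k) cinterval" "t \<in> nbhd (\<delta> k) cinterval"
  shows "q / 2 * cmod (s - t) \<le> cmod (H k (z(k := s)) - H k (z(k := t)))"
proof (cases "s = t")
  case False
  obtain u where u: "u \<in> closed_segment t s"
    "Re (H k (z(k := s)) / (s - t)) - Re (H k (z(k := t)) / (s - t)) = Re (cnd k (z(k := u)) / (s - t) * (s - t))"
    using complex_mvt_line[of t s "\<lambda>u. H k (z(k := u)) / (s - t)" "\<lambda>u. cnd k (z(k := u)) / (s - t)",
        OF DERIV_cdivide[OF H_deriv[OF k z segment_in_nbhd[OF s(2,1)]]]] by blast
  have "q / 2 \<le> Re (cnd k (z(k := u)))"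
    using u(1) s by (intro cnd_bounds k upd_in_dom z) (auto intro: segment_in_nbhd)
  also have "\<dots> = Re ((H k (z(k := s)) - H k (z(k := t))) / (s - t))"
    using u(2) False by (simp add: diff_divide_distrib)
  also have "\<dots> \<le> cmod ((H k (z(k := s)) - H k (z(k := t))) / (s - t))" by (rule complex_Re_le_cmod)
  finally show ?thesis using False by (simp add: norm_divide pos_le_divide_eq)
qed simp

lemma H_Re_mono:
  assumes k: "k \<in> {1..d}" and z: "z \<in> poly_dom (k - 1) \<delta>" and st: "-1 \<le> s" "s \<le> t" "t \<le> 1"
  shows "Re (H k (z(k := of_real s))) \<le> Re (H k (z(k := of_real t)))"
proof -
  have V: "complex_of_real s \<in> nbhd (\<delta> k) cinterval" "complex_of_real t \<in> nbhd (\<delta> k) cinterval"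
    using st k \<delta>_pos by (auto intro!: of_real_in_nbhd)
  obtain u where u: "u \<in> closed_segment (complex_of_real s) (of_real t)"
    "Re (H k (z(k := of_real t))) - Re (H k (z(k := of_real s))) = Re (cnd k (z(k := u)) * (of_real t - of_real s))"
    using complex_mvt_line[of "complex_of_real s" "of_real t" "\<lambda>u. H k (z(k := u))" "\<lambda>u. cnd k (z(k := u))"]
      H_deriv[OF k z segment_in_nbhd[OF V]] by blast
  have "0 \<le> Re (cnd k (z(k := u)))"
    using cnd_bounds(1)[OF k upd_in_dom[OF z segment_in_nbhd[OF V u(1)]]] q_pos by linarith
  then have "0 \<le> Re (cnd k (z(k := u))) * (t - s)" using st by simp
  then show ?thesis using u(2) by simp
qed

text \<open>Parametrising the segment over the unit interval turns the moving endpoint into the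
  factor \<open>\<gamma> l k + 1\<close> times a parametric integral over a fixed finite
  measure.\<close>

lemma curve_holomorphic_H:
  assumes k: "k \<in> {1..d}"
  shows "curve_holomorphic (H k) (poly_dom k \<delta>)"
  unfolding curve_holomorphic_def
proof (intro allI impI)
  fix \<gamma> :: "complex \<Rightarrow> nat \<Rightarrow> complex" and W :: "complex set"
  assume W: "open W" and hol: "\<forall>i. (\<lambda>l. \<gamma> l i) holomorphic_on W" and U: "\<forall>l\<in>W. \<gamma> l \<in> poly_dom k \<delta>"
  define g where "g l u = cnd k ((\<gamma> l)(k := linepath (-1) (\<gamma> l k) u))" for l and u :: real
  let ?N = "lebesgue_on {0..1::real}"
  interpret finite_measure ?N by (rule finite_measure_lebesgue_on) auto
  have z: "\<gamma> l \<in> poly_dom (k - 1) \<delta>" "\<gamma> l k \<in> nbhd (\<delta> k) cinterval" if "l \<in> W" for l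
    using U that k by (auto simp: poly_dom_def)
  have seg: "linepath (-1) (\<gamma> l k) u \<in> nbhd (\<delta> k) cinterval" if "l \<in> W" "u \<in> {0..1}" for l u
    using z[OF that(1)] that(2) \<delta>_pos[OF k]
    by (intro segment_in_nbhd[OF minus_one_in_nbhd z(2)[OF that(1)]]) (auto simp: linepath_in_path)
  have gb: "cmod (g l u) \<le> 2 / q" if "l \<in> W" "u \<in> {0..1}" for l u
    unfolding g_def using that by (intro cnd_bounds k upd_in_dom z seg)
  have meas: "g l \<in> borel_measurable ?N" if "l \<in> W" for l
  proof (rule continuous_imp_measurable_on_sets_lebesgue)
    show "continuous_on {0..1} (g l)"
      unfolding g_def
      by (rule continuous_on_compose2[OF holomorphic_on_imp_continuous_on[OF cnd_line_holomorphic[OF k z(1)[OF that]]]])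
        (use seg[OF that] in auto)
  qed simp
  have "H k (\<gamma> l) = (\<gamma> l k + 1) * (\<integral>u. g l u \<partial>?N)" if "l \<in> W" for l
  proof -
    have "(\<integral>u. g l u \<partial>?N) = integral {0..1} (g l)"
      using gb[OF that] meas[OF that]
      by (intro lebesgue_integral_eq_integral integrable_const_bound[of _ "2 / q"]) auto
    moreover have "H k (\<gamma> l) = integral {0..1} (\<lambda>u. g l u * (\<gamma> l k + 1))"
      by (simp add: H_def contour_integral_integral g_def)
    ultimately show ?thesis by (simp add: mult.commute)
  qed
  moreover have "(\<lambda>l. (\<gamma> l k + 1) * (\<integral>u. g l u \<partial>?N)) holomorphic_on W"
  proof (intro holomorphic_intros holomorphic_on_integral[OF W meas])
    show "(\<lambda>l. \<gamma> l k) holomorphic_on W" using hol by blast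
    fix u assume u: "u \<in> space ?N"
    show "(\<lambda>l. g l u) holomorphic_on W"
      unfolding g_def
    proof (rule curve_holomorphicD[OF curve_holomorphic_cnd W, where \<gamma> = "\<lambda>l. (\<gamma> l)(k := linepath (-1) (\<gamma> l k) u)"])
      show "(\<lambda>l. ((\<gamma> l)(k := linepath (-1) (\<gamma> l k) u)) i) holomorphic_on W" for i
        using hol by (cases "i = k") (auto simp: linepath_def scaleR_conv_of_real intro!: holomorphic_intros)
    qed (use k u in \<open>auto intro!: upd_in_dom z seg\<close>)
    show "cmod (g l u) \<le> 2 / q" if "l \<in> W" for l using gb[OF that] u by simp
  qed
  ultimately show "(\<lambda>l. H k (\<gamma> l)) holomorphic_on W" by (simp cong: holomorphic_cong)
qed

text \<open>Mean 1 also for complex \<open>z\<close>: this fixes the value 2 of \<open>H\<close> at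
  the right endpoint and is the source of the decay in (ii).\<close>

lemma integral_cnd:
  assumes k: "k \<in> {1..d}" and z: "z \<in> poly_dom (k - 1) \<delta>"
  shows "(\<lambda>s. cnd k (z(k := complex_of_real s))) \<in> borel_measurable half_lebesgue"
    and "(\<integral>s. cnd k (z(k := complex_of_real s)) \<partial>half_lebesgue) = 1"
proof -
  have e: "cnd k (z(k := s)) = P k (z(k := s)) / P (k - 1) z" for s
    unfolding cnd_def using k by (intro arg_cong2[of _ _ _ _ "(/)"] P_cong) auto
  show "(\<lambda>s. cnd k (z(k := complex_of_real s))) \<in> borel_measurable half_lebesgue"
    unfolding e using P_marginalize(1)[OF k z] by measurable
  have "P (k - 1) z \<noteq> 0" using k z by (intro P_nonzero) auto
  then show "(\<integral>s. cnd k (z(k := complex_of_real s)) \<partial>half_lebesgue) = 1"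
    unfolding e using P_marginalize(2)[OF k z] by simp
qed

lemma of_real_in_nbhd': "k \<in> {1..d} \<Longrightarrow> t \<in> {-1..1} \<Longrightarrow> complex_of_real t \<in> nbhd (\<delta> k) cinterval"
  using \<delta>_pos by (intro of_real_in_nbhd) auto

lemma continuous_on_cnd_real:
  assumes k: "k \<in> {1..d}" and z: "z \<in> poly_dom (k - 1) \<delta>"
  shows "continuous_on {-1..1} (\<lambda>s. cnd k (z(k := complex_of_real s)))"
  by (rule continuous_on_compose2[OF holomorphic_on_imp_continuous_on[OF cnd_line_holomorphic[OF k z]]])
    (use of_real_in_nbhd'[OF k] in \<open>auto intro!: continuous_intros\<close>)

lemma H_one:
  assumes k: "k \<in> {1..d}" and z: "z \<in> poly_dom (k - 1) \<delta>"
  shows "H k (z(k := 1)) = 2"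
proof -
  note cont = continuous_on_cnd_real[OF k z]
  have "H k (z(k := 1)) = integral {-1..1} (\<lambda>s. cnd k (z(k := complex_of_real s)))"
    by (simp add: H_def contour_integral_linepath_Reals_eq)
  also have "\<dots> = (LBINT s:{-1..1}. cnd k (z(k := complex_of_real s)))"
    using borel_integrable_atLeastAtMost'[OF cont] by (rule set_borel_integral_eq_integral(2)[symmetric])
  also have "\<dots> = 2 *\<^sub>R (\<integral>s. cnd k (z(k := complex_of_real s)) \<partial>half_lebesgue)"
    by (subst integral_half_lebesgue[OF borel_measurable_continuous_on_restrict[OF cont]]) simp
  also have "\<dots> = 2" using integral_cnd(2)[OF k z] by (simp add: scaleR_conv_of_real)
  finally show ?thesis .
qed

lemma H_real:
  assumes k: "k \<in> {1..d}" and x: "\<And>i. i \<in> {1..k} \<Longrightarrow> x i \<in> {-1..1}"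
  shows "H k (\<lambda>i. of_real (x i)) = of_real (cond_cdf d f k x)"
proof -
  have xk: "x k \<in> {-1..1}" using x k by auto
  define c where "c t = conditional d f k (x(k := t))" for t
  have z: "(\<lambda>i. complex_of_real (x i)) \<in> poly_dom (k - 1) \<delta>"
    using k x by (intro real_in_dom) auto
  have cc: "cnd k ((\<lambda>i. complex_of_real (x i))(k := of_real t)) = of_real (c t)" if "t \<in> {-1..1}" for t
  proof -
    have "(\<lambda>i. complex_of_real (x i))(k := of_real t) = (\<lambda>i. of_real ((x(k := t)) i))" by auto
    then show ?thesis unfolding c_def using cnd_real(1)[of k "x(k := t)"] k x that by (simp only:) auto
  qed
  have "continuous_on {-1..1} (\<lambda>t. Re (cnd k ((\<lambda>i. complex_of_real (x i))(k := of_real t))))"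
    by (intro continuous_intros continuous_on_cnd_real k z)
  then have "continuous_on {-1..1} c"
    by (rule continuous_on_eq) (simp only: cc Re_complex_of_real)
  then have cont: "continuous_on {-1..x k} c" by (rule continuous_on_subset) (use xk in auto)
  have "(c has_integral cond_cdf d f k x) {-1..x k}"
    using set_borel_integral_eq_integral[OF borel_integrable_atLeastAtMost'[OF cont]]
    unfolding cond_cdf_def c_def[symmetric] by (simp add: has_integral_iff)
  then have hi: "((\<lambda>t. complex_of_real (c t)) has_integral of_real (cond_cdf d f k x)) {-1..x k}"
    by (rule has_integral_of_real)
  have "integral {-1..x k} (\<lambda>t. cnd k ((\<lambda>i. complex_of_real (x i))(k := of_real t)))
     = integral {-1..x k} (\<lambda>t. of_real (c t))"
    using xk by (intro Henstock_Kurzweil_Integration.integral_cong cc) auto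
  with hi have I: "integral {-1..x k} (\<lambda>t. cnd k ((\<lambda>i. complex_of_real (x i))(k := of_real t))) = of_real (cond_cdf d f k x)"
    by (simp add: integral_unique)
  show ?thesis
  proof (cases "x k = -1")
    \<comment> \<open>The degenerate segment is separate: the contour integral is rewritten as a
      real integral only for a left endpoint below the right one.\<close>
    case True
    then show ?thesis using I by (simp add: H_def)
  next
    case False
    then show ?thesis using I xk by (simp add: H_def contour_integral_linepath_Reals_eq)
  qed
qed

text \<open>On the real segment only the first \<open>k - 1\<close> coordinates differ from real
  ones, so \<open>cnd_close_last\<close> bounds the derivative of the difference, and the length is
  at most 2. The factor \<open>\<delta> k\<close> gained here makes the error comparable with the
  radius in which a root is sought.\<close>

lemma H_close:
  assumes k: "k \<in> {1..d}" and x: "\<And>i. i \<in> {1..k-1} \<Longrightarrow> x i \<in> {-1..1}"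
    and z: "\<And>i. i \<in> {1..k-1} \<Longrightarrow> cmod (z i - of_real (x i)) < \<delta> i" and s: "s \<in> {-1..1}"
  shows "cmod (H k (z(k := of_real s)) - H k ((\<lambda>i. of_real (x i))(k := of_real s))) \<le> 2 * \<theta> * \<delta> k"
proof -
  let ?X = "\<lambda>i. complex_of_real (x i)"
  define g where "g s = H k (z(k := s)) - H k (?X(k := s))" for s
  have dz: "z \<in> poly_dom (k - 1) \<delta>" using x z by (rule near_real_in_dom)
  have dX: "?X \<in> poly_dom (k - 1) \<delta>" using k x by (intro real_in_dom) auto
  have "cmod (g (of_real s) - g (-1)) \<le> \<theta> * \<delta> k * cmod (of_real s - (- 1))"
  proof (rule field_differentiable_bound[where S = "closed_segment (-1) (of_real s)" and f' = "\<lambda>u. cnd k (z(k := u)) - cnd k (?X(k := u))"])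
    fix u assume "u \<in> closed_segment (- 1) (complex_of_real s)"
    then have "u \<in> complex_of_real ` closed_segment (-1) s"
      using closed_segment_of_real[of "-1" s, where 'a = complex] by simp
    then obtain t where t: "u = of_real t" "t \<in> {-1..1}"
      using s by (auto simp: closed_segment_eq_real_ivl split: if_splits)
    show "(g has_field_derivative cnd k (z(k := u)) - cnd k (?X(k := u))) (at u within closed_segment (- 1) (of_real s))"
      unfolding g_def using t of_real_in_nbhd'[OF k t(2)]
      by (intro has_field_derivative_at_within[OF DERIV_diff] H_deriv k dz dX) auto
    have "cmod (cnd k (z(k := u)) - cnd k (\<lambda>i. of_real ((x(k := t)) i))) \<le> \<theta> * \<delta> k"
      using k x z t by (intro cnd_close_last) auto
    moreover have "(\<lambda>i. of_real ((x(k := t)) i)) = ?X(k := u)" using t by auto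
    ultimately show "cmod (cnd k (z(k := u)) - cnd k (?X(k := u))) \<le> \<theta> * \<delta> k" by simp
  qed auto
  moreover have "g (- 1) = 0" by (simp add: g_def H_start)
  moreover have "cmod (of_real s - (- 1)) \<le> 2"
    using s norm_of_real[of "s + 1", where ?'a = complex] by simp
  then have "\<theta> * \<delta> k * cmod (of_real s - (- 1)) \<le> \<theta> * \<delta> k * 2"
    using \<theta>_pos \<delta>_pos[OF k] by (intro mult_left_mono) auto
  ultimately show ?thesis by (simp add: g_def mult.commute mult.left_commute)
qed

text \<open>Discs of radius \<open>\<delta> k / 2\<close> about points of the half neighbourhood
  stay in the full one, where the conditional is at most \<open>2 / q\<close>; Cauchy's estimate
  gives the constant.\<close>

lemma cnd_lipschitz:
  assumes k: "k \<in> {1..d}" and z: "z \<in> poly_dom (k - 1) \<delta>"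
    and s: "s \<in> nbhd (\<delta> k / 2) cinterval" "t \<in> nbhd (\<delta> k / 2) cinterval"
  shows "cmod (cnd k (z(k := s)) - cnd k (z(k := t))) \<le> 8 / (q * \<delta> k) * cmod (s - t)"
proof (rule field_differentiable_bound[OF convex_nbhd_cinterval])
  fix u assume u: "u \<in> nbhd (\<delta> k / 2) cinterval"
  have d: "0 < \<delta> k" using \<delta>_pos k by auto
  have u': "u \<in> nbhd (\<delta> k) cinterval" using u nbhd_mono[of "\<delta> k / 2" "\<delta> k" cinterval] d by auto
  let ?g = "\<lambda>s. cnd k (z(k := s))"
  show "(?g has_field_derivative deriv ?g u) (at u within nbhd (\<delta> k / 2) cinterval)"
    using cnd_line_holomorphic[OF k z] u' open_nbhd by (intro has_field_derivative_at_within[OF holomorphic_derivI])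
  have "cmod (deriv ?g u) \<le> 2 * (2 / q) / (\<delta> k / 2)"
  proof (rule norm_deriv_le)
    show "?g holomorphic_on ball u (\<delta> k / 2)"
      by (rule holomorphic_on_subset[OF cnd_line_holomorphic[OF k z] ball_subset_nbhd[OF u]])
    show "cmod (?g y) \<le> 2 / q" if "y \<in> ball u (\<delta> k / 2)" for y
      using ball_subset_nbhd[OF u] that by (intro cnd_bounds k upd_in_dom z) auto
  qed (use d in auto)
  then show "cmod (deriv ?g u) \<le> 8 / (q * \<delta> k)" by (simp add: field_simps)
qed (use s in auto)

text \<open>A function of mean 1 differs from 1 by at most its oscillation, here the Lipschitz
  constant times the length 2.\<close>

lemma cnd_near_1:
  assumes k: "k \<in> {1..d}" and z: "z \<in> poly_dom (k - 1) \<delta>" and s: "s \<in> {-1..1}"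
  shows "cmod (cnd k (z(k := of_real s)) - 1) \<le> 16 / (q * \<delta> k)"
proof -
  let ?g = "\<lambda>s. cnd k (z(k := complex_of_real s))"
  have d: "0 < \<delta> k" using \<delta>_pos k by auto
  interpret prob_space half_lebesgue by (rule prob_space_half_lebesgue)
  have bd: "cmod (?g t) \<le> 2 / q" if "t \<in> {-1..1}" for t
    using that by (intro cnd_bounds k upd_in_dom z of_real_in_nbhd')
  have int: "integrable half_lebesgue ?g"
    by (rule integrable_bounded(1)[OF integral_cnd(1)[OF k z], of "2 / q"]) (use bd in simp)
  have "?g s - 1 = (\<integral>t. ?g s \<partial>half_lebesgue) - (\<integral>t. ?g t \<partial>half_lebesgue)"
    by (simp add: integral_cnd(2)[OF k z] prob_space[simplified])
  also have "\<dots> = (\<integral>t. ?g s - ?g t \<partial>half_lebesgue)"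
    using int by (intro Bochner_Integration.integral_diff[symmetric]) auto
  also have "cmod \<dots> \<le> 16 / (q * \<delta> k)"
  proof (rule integrable_bounded(2))
    show "(\<lambda>t. ?g s - ?g t) \<in> borel_measurable half_lebesgue"
      using integral_cnd(1)[OF k z] by measurable
    fix t assume t: "t \<in> space half_lebesgue"
    have "cmod (?g s - ?g t) \<le> 8 / (q * \<delta> k) * cmod (of_real s - of_real t :: complex)"
      using s t d by (intro cnd_lipschitz k z of_real_in_nbhd) auto
    also have "\<dots> \<le> 8 / (q * \<delta> k) * 2"
    proof (rule mult_left_mono)
      have "\<bar>s - t\<bar> \<le> 2" using s t by auto
      then show "cmod (of_real s - of_real t :: complex) \<le> 2"
        by (metis norm_of_real of_real_diff)
    qed (use q_pos d in auto)
    finally show "cmod (?g s - ?g t) \<le> 16 / (q * \<delta> k)" by simp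
  qed
  finally show ?thesis .
qed

end

subsection \<open>The complexified transport\<close>

lemma poly_domD: "z \<in> poly_dom k r \<Longrightarrow> i \<in> {1..k} \<Longrightarrow> z i \<in> nbhd (r i) cinterval"
  by (simp add: poly_dom_def)

text \<open>At real \<open>s\<close> the first bound is independent of \<open>\<delta> k\<close>, as
  (ii) requires; the second is the uniform bound for the implicit function argument.\<close>

lemma (in holomorphic_density) H_bound:
  assumes k: "k \<in> {1..d}" and z: "z \<in> poly_dom (k - 1) \<delta>" and s: "s \<in> nbhd (\<delta> k) cinterval"
  shows "cmod (H k (z(k := s))) \<le> 2 / q * cmod (s + 1)"
    and "cmod (H k (z(k := s))) \<le> 2 / q * (2 + \<delta> k)"
proof -
  show 1: "cmod (H k (z(k := s))) \<le> 2 / q * cmod (s + 1)"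
    using H_upper[OF k z s, of "-1"] \<delta>_pos[OF k] by (simp add: H_start minus_one_in_nbhd)
  obtain y where y: "y \<in> {-1..1}" "norm (s - of_real y) < \<delta> k" using s by (rule nbhd_cintervalE)
  have "cmod (of_real (y + 1)) \<le> 2" using y(1) unfolding norm_of_real by auto
  then have "cmod (s + 1) \<le> 2 + \<delta> k"
    using norm_triangle_mono[OF less_imp_le[OF y(2)], of "of_real (y + 1)" 2] by (simp add: add.commute)
  then have "2 / q * cmod (s + 1) \<le> 2 / q * (2 + \<delta> k)" using q_pos by (intro mult_left_mono) auto
  with 1 show "cmod (H k (z(k := s))) \<le> 2 / q * (2 + \<delta> k)" by linarith
qed

locale transport = rho: holomorphic_density d \<delta> M L f F + pi: holomorphic_density d \<delta> M L g G
  for d :: nat and \<delta> :: "nat \<Rightarrow> real" and M L :: real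
    and f g :: "(nat \<Rightarrow> real) \<Rightarrow> real" and F G :: "(nat \<Rightarrow> complex) \<Rightarrow> complex"
begin

abbreviation "q \<equiv> rho.q"

text \<open>A shift of the last coordinate by less than \<open>\<zeta> k\<close> changes
  \<open>H\<close> by at most \<open>2 / q * \<zeta> k = q / 32 * \<delta> k\<close>, half of the
  error budget in \<open>complex_root\<close>.\<close>

definition \<zeta> where "\<zeta> j = q ^ 2 / 64 * \<delta> j"

lemma \<zeta>_less: "j \<in> {1..d} \<Longrightarrow> \<zeta> j < \<delta> j"
proof -
  assume j: "j \<in> {1..d}"
  have "q ^ 2 \<le> 1" using rho.q_pos rho.q_le_1 by (intro power_le_one) auto
  then have "q ^ 2 / 64 * \<delta> j < 1 * \<delta> j" using rho.\<delta>_pos[OF j] by (intro mult_strict_right_mono) auto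
  then show ?thesis by (simp add: \<zeta>_def)
qed

lemma dom_mono_radius:
  "z \<in> poly_dom k r \<Longrightarrow> (\<And>j. j \<in> {1..k} \<Longrightarrow> r j \<le> r' j) \<Longrightarrow> z \<in> poly_dom k r'"
  unfolding poly_dom_def using nbhd_mono by blast

lemma \<zeta>_dom: "k \<le> d \<Longrightarrow> z \<in> poly_dom k \<zeta> \<Longrightarrow> z \<in> poly_dom k \<delta>"
  by (erule dom_mono_radius) (intro less_imp_le \<zeta>_less, auto)

lemma half_dom: "k \<le> d \<Longrightarrow> z \<in> poly_dom k (\<lambda>j. \<delta> j / 2) \<Longrightarrow> z \<in> poly_dom k \<delta>"
proof (erule dom_mono_radius)
  show "\<delta> j / 2 \<le> \<delta> j" if "k \<le> d" "j \<in> {1..k}" for j using rho.\<delta>_pos[of j] that by simp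
qed

section \<open>Solving the defining equation\<close>

lemma real_root:
  assumes k: "k \<in> {1..d}" and x: "\<And>i. i \<in> {1..k} \<Longrightarrow> x i \<in> {-1..1}"
    and y: "\<And>i. i \<in> {1..k-1} \<Longrightarrow> y i \<in> {-1..1}"
  obtains s where "s \<in> {-1..1}"
    "pi.H k ((\<lambda>i. of_real (y i))(k := complex_of_real s)) = rho.H k (\<lambda>i. of_real (x i))"
proof -
  let ?X = "\<lambda>i. complex_of_real (x i)" and ?Y = "\<lambda>i. complex_of_real (y i)"
  have X: "?X \<in> poly_dom (k - 1) \<delta>" using k x by (intro rho.real_in_dom) auto
  have Y: "?Y \<in> poly_dom (k - 1) \<delta>" using k y by (intro rho.real_in_dom) auto
  have xk: "x k \<in> {-1..1}" using x k by auto
  have XX: "?X(k := of_real (x k)) = ?X" by auto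
  define a where "a = cond_cdf d f k x"
  have a: "rho.H k ?X = of_real a" unfolding a_def by (rule rho.H_real[OF k x])
  have "Re (rho.H k (?X(k := of_real (-1)))) \<le> Re (rho.H k (?X(k := of_real (x k))))"
    using xk by (intro rho.H_Re_mono k X) auto
  then have a0: "0 \<le> a" unfolding XX a by (simp add: rho.H_start)
  have "Re (rho.H k (?X(k := of_real (x k)))) \<le> Re (rho.H k (?X(k := of_real 1)))"
    using xk by (intro rho.H_Re_mono k X) auto
  then have a2: "a \<le> 2" unfolding XX a using rho.H_one[OF k X] by simp
  define h where "h t = Re (pi.H k (?Y(k := complex_of_real t)))" for t
  have "continuous_on (nbhd (\<delta> k) cinterval) (\<lambda>s. pi.H k (?Y(k := s)))"
    by (rule DERIV_continuous_on[OF has_field_derivative_at_within[OF pi.H_deriv[OF k Y]]])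
  then have "continuous_on {-1..1} (\<lambda>t. pi.H k (?Y(k := complex_of_real t)))"
    by (rule continuous_on_compose2) (auto intro!: continuous_intros rho.of_real_in_nbhd' k)
  then have "continuous_on {-1..1} h" unfolding h_def by (intro continuous_intros)
  moreover have "h (-1) \<le> a" "a \<le> h 1"
    using a0 a2 pi.H_one[OF k Y] by (simp_all add: h_def pi.H_start)
  ultimately obtain s where s: "-1 \<le> s" "s \<le> 1" "h s = a"
    using IVT'[of h "-1" a 1] by auto
  have YY: "?Y(k := complex_of_real s) = (\<lambda>i. of_real ((y(k := s)) i))" by auto
  \<comment> \<open>The intermediate value theorem has matched real parts only; at real points
    \<open>pi.H\<close> is real, so the full equation follows.\<close>
  have "pi.H k (?Y(k := complex_of_real s)) = of_real (cond_cdf d g k (y(k := s)))"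
    unfolding YY using s y by (intro pi.H_real[OF k]) auto
  then have "pi.H k (?Y(k := complex_of_real s)) = of_real (h s)" by (simp add: h_def)
  then show ?thesis using that[of s] s a by simp
qed

text \<open>The root is trapped around the solution of a real equation by the minimum modulus
  principle. The parameters \<open>z\<close> and \<open>w\<close> need not be related: each has its
  own nearby real point.\<close>

lemma complex_root:
  assumes k: "k \<in> {1..d}" and z: "z \<in> poly_dom k \<zeta>" and w: "w \<in> poly_dom (k - 1) \<delta>"
  obtains s where "s \<in> nbhd (\<delta> k / 2) cinterval" "pi.H k (w(k := s)) = rho.H k z"
proof -
  have d: "0 < \<delta> k" using rho.\<delta>_pos[OF k] .
  obtain x where x: "\<And>i. i \<in> {1..k} \<Longrightarrow> x i \<in> {-1..1}"
    "\<And>i. i \<in> {1..k} \<Longrightarrow> cmod (z i - of_real (x i)) < \<zeta> i"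
    using poly_dom_realE[OF z] by metis
  obtain y where y: "\<And>i. i \<in> {1..k-1} \<Longrightarrow> y i \<in> {-1..1}"
    "\<And>i. i \<in> {1..k-1} \<Longrightarrow> cmod (w i - of_real (y i)) < \<delta> i"
    using poly_dom_realE[OF w] by metis
  obtain s0 where s0: "s0 \<in> {-1..1}"
    "pi.H k ((\<lambda>i. of_real (y i))(k := complex_of_real s0)) = rho.H k (\<lambda>i. of_real (x i))"
    using real_root[of k x y, OF k x(1) y(1)] by metis
  have zd: "z \<in> poly_dom k \<delta>" using k z by (intro \<zeta>_dom) auto
  then have zd': "z \<in> poly_dom (k - 1) \<delta>" by (rule poly_dom_mono) simp
  have zk: "z k \<in> nbhd (\<delta> k) cinterval" using zd k by (auto simp: poly_dom_def)
  have xk: "x k \<in> {-1..1}" "cmod (z k - of_real (x k)) < \<zeta> k" using x k by auto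
  have XX: "(\<lambda>i. complex_of_real (x i))(k := of_real (x k)) = (\<lambda>i. of_real (x i))" by auto
  have xz: "cmod (z i - of_real (x i)) < \<delta> i" if "i \<in> {1..k-1}" for i
  proof -
    have "i \<in> {1..k}" "i \<in> {1..d}" using that k by auto
    then show ?thesis using x(2)[of i] \<zeta>_less[of i] by linarith
  qed
  \<comment> \<open>Three errors are added: \<open>w\<close> against \<open>y\<close>, the first
    \<open>k - 1\<close> coordinates of \<open>z\<close> against \<open>x\<close>, and finally the
    last coordinate of \<open>z\<close>.\<close>
  have 1: "cmod (pi.H k (w(k := of_real s0)) - rho.H k (\<lambda>i. of_real (x i))) \<le> 2 * rho.\<theta> * \<delta> k"
    unfolding s0(2)[symmetric] by (rule pi.H_close[OF k y s0(1)])
  have "cmod (rho.H k (z(k := of_real (x k))) - rho.H k ((\<lambda>i. of_real (x i))(k := of_real (x k)))) \<le> 2 * rho.\<theta> * \<delta> k"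
    using x(1) xz xk(1) by (intro rho.H_close[OF k]) auto
  then have 2: "cmod (rho.H k (\<lambda>i. of_real (x i)) - rho.H k (z(k := of_real (x k)))) \<le> 2 * rho.\<theta> * \<delta> k"
    unfolding XX by (simp add: norm_minus_commute)
  have "cmod (rho.H k (z(k := of_real (x k))) - rho.H k (z(k := z k))) \<le> 2 / q * cmod (of_real (x k) - z k)"
    by (intro rho.H_upper[OF k zd'] zk rho.of_real_in_nbhd' k xk)
  also have "\<dots> \<le> 2 / q * \<zeta> k"
    using xk(2) rho.q_pos by (intro mult_left_mono) (auto simp: norm_minus_commute)
  also have "\<dots> = q / 32 * \<delta> k" using rho.q_pos by (simp add: \<zeta>_def power2_eq_square)
  finally have 3: "cmod (rho.H k (z(k := of_real (x k))) - rho.H k z) \<le> q / 32 * \<delta> k" by simp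
  define h where "h s = pi.H k (w(k := s)) - rho.H k z" for s
  have "cmod (h (of_real s0)) \<le> 2 * rho.\<theta> * \<delta> k + (2 * rho.\<theta> * \<delta> k + q / 32 * \<delta> k)"
    using norm_triangle_mono[OF 1 norm_triangle_mono[OF 2 3]] by (simp add: h_def)
  also have "\<dots> \<le> 2 * (q / 128) * \<delta> k + (2 * (q / 128) * \<delta> k + q / 32 * \<delta> k)"
    using d rho.\<theta>_le by (intro add_mono mult_right_mono) auto
  also have "\<dots> = q * \<delta> k / 16" by (simp add: field_simps)
  finally have h0: "cmod (h (of_real s0)) \<le> q * \<delta> k / 16" .
  have cb: "cball (complex_of_real s0) (\<delta> k / 3) \<subseteq> nbhd (\<delta> k) cinterval"
    using s0(1) d by (auto simp: dist_norm norm_minus_commute intro!: nbhd_cintervalI[of s0])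
  have hd: "(h has_field_derivative pi.cnd k (w(k := s))) (at s)" if "s \<in> nbhd (\<delta> k) cinterval" for s
    unfolding h_def using pi.H_deriv[OF k w that] by (auto intro!: derivative_eq_intros)
  have hh: "h holomorphic_on nbhd (\<delta> k) cinterval"
    unfolding holomorphic_on_open[OF open_nbhd] using hd by blast
  \<comment> \<open>On the circle \<open>h\<close> differs from its central value by at least
    \<open>q / 2 * (\<delta> k / 3) = q * \<delta> k / 6\<close>, while that value is at most
    \<open>q * \<delta> k / 16\<close>; so \<open>h\<close> is larger on the circle than at the
    centre and must vanish inside. The fraction 1/3 lies below the 1/2 to be reached.\<close>
  obtain s where s: "s \<in> ball (complex_of_real s0) (\<delta> k / 3)" "h s = 0"
  proof (rule holomorphic_contract_to_zero)
    show "continuous_on (cball (complex_of_real s0) (\<delta> k / 3)) h"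
      using holomorphic_on_imp_continuous_on[OF hh] cb by (rule continuous_on_subset)
    show "h holomorphic_on ball (complex_of_real s0) (\<delta> k / 3)"
      using hh cb ball_subset_cball by (meson holomorphic_on_subset subset_trans)
    fix u assume u: "cmod (of_real s0 - u) = \<delta> k / 3"
    then have "u \<in> nbhd (\<delta> k) cinterval" and e: "cmod (u - of_real s0) = \<delta> k / 3"
      using cb by (auto simp: dist_norm norm_minus_commute)
    from pi.H_lower[OF k w this(1) rho.of_real_in_nbhd'[OF k s0(1)]]
    have "q / 2 * (\<delta> k / 3) \<le> cmod (h u - h (of_real s0))"
      unfolding e by (simp add: h_def)
    moreover have "cmod (h u - h (of_real s0)) \<le> cmod (h u) + cmod (h (of_real s0))" by (rule norm_triangle_ineq4)
    moreover have "0 < q * \<delta> k" using rho.q_pos d by simp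
    ultimately show "cmod (h (of_real s0)) < cmod (h u)" using h0 by simp
  qed (use d that in auto)
  have "s \<in> nbhd (\<delta> k / 2) cinterval"
    using s(1) s0(1) d by (intro nbhd_cintervalI[of s0]) (auto simp: dist_norm norm_minus_commute)
  then show ?thesis using that s(2) by (simp add: h_def)
qed

lemma root_unique:
  assumes "k \<in> {1..d}" "w \<in> poly_dom (k - 1) \<delta>" "s \<in> nbhd (\<delta> k) cinterval" "t \<in> nbhd (\<delta> k) cinterval"
    "pi.H k (w(k := s)) = pi.H k (w(k := t))"
  shows "s = t"
  using pi.H_lower[OF assms(1-4)] assms(5) rho.q_pos by (simp add: mult_le_0_iff)

text \<open>
  \<open>T k z\<close> is the whole vector of the complexified components \<open>T\<^sub>1, \<dots>, T\<^sub>k\<close> at \<open>z\<close>, not just \<open>T\<^sub>k\<close>. The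
  choice is made from a singleton when \<open>z \<in> poly_dom (Suc k) \<zeta>\<close>.
\<close>

primrec T :: "nat \<Rightarrow> (nat \<Rightarrow> complex) \<Rightarrow> nat \<Rightarrow> complex" where
  "T 0 z = (\<lambda>_. 0)"
| "T (Suc k) z = (T k z)(Suc k := (SOME s. s \<in> nbhd (\<delta> (Suc k) / 2) cinterval \<and>
     pi.H (Suc k) ((T k z)(Suc k := s)) = rho.H (Suc k) z))"

lemma T_cong: "(\<And>i. i \<in> {1..k} \<Longrightarrow> z i = w i) \<Longrightarrow> T k z = T k w"
proof (induction k)
  case (Suc k)
  then have "T k z = T k w" by auto
  moreover have "rho.H (Suc k) z = rho.H (Suc k) w" using Suc.prems by (intro rho.H_cong) auto
  ultimately show ?case by simp
qed simp

lemma T_upd: "1 \<le> k \<Longrightarrow> (T (k - 1) z)(k := T k z k) = T k z"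
  by (cases k) auto

text \<open>The induction closes with unchanged radii, since halving them is exactly what
  \<open>complex_root\<close> returns and less than what it demands of the lower components.\<close>

lemma T_properties:
  assumes "k \<le> d" "z \<in> poly_dom k \<zeta>"
  shows "T k z \<in> poly_dom k (\<lambda>j. \<delta> j / 2)" and "1 \<le> k \<Longrightarrow> pi.H k (T k z) = rho.H k z"
proof -
  have "T k z \<in> poly_dom k (\<lambda>j. \<delta> j / 2) \<and> (1 \<le> k \<longrightarrow> pi.H k (T k z) = rho.H k z)"
    using assms
  proof (induction k)
    case (Suc k)
    have IH: "T k z \<in> poly_dom k (\<lambda>j. \<delta> j / 2)"
      using Suc poly_dom_mono[OF Suc.prems(2)] by auto
    have k: "Suc k \<in> {1..d}" using Suc.prems by auto
    have w: "T k z \<in> poly_dom (Suc k - 1) \<delta>" using half_dom[OF _ IH] Suc.prems by simp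
    define s where "s = T (Suc k) z (Suc k)"
    obtain t where t: "t \<in> nbhd (\<delta> (Suc k) / 2) cinterval \<and> pi.H (Suc k) ((T k z)(Suc k := t)) = rho.H (Suc k) z"
      using complex_root[OF k Suc.prems(2) w] by metis
    have s: "s \<in> nbhd (\<delta> (Suc k) / 2) cinterval \<and> pi.H (Suc k) ((T k z)(Suc k := s)) = rho.H (Suc k) z"
      using someI[of "\<lambda>s. s \<in> nbhd (\<delta> (Suc k) / 2) cinterval \<and> pi.H (Suc k) ((T k z)(Suc k := s)) = rho.H (Suc k) z", OF t]
      by (simp add: s_def)
    have e: "T (Suc k) z = (T k z)(Suc k := s)" by (simp add: s_def)
    show ?case
      unfolding e using s rho.upd_in_dom[of "T k z" "Suc k" "\<lambda>j. \<delta> j / 2" s] IH by (simp del: fun_upd_apply)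
  qed (simp add: poly_dom_def)
  then show "T k z \<in> poly_dom k (\<lambda>j. \<delta> j / 2)" "1 \<le> k \<Longrightarrow> pi.H k (T k z) = rho.H k z" by auto
qed

lemma T_in_dom: "k \<le> d \<Longrightarrow> z \<in> poly_dom k \<zeta> \<Longrightarrow> T k z \<in> poly_dom k \<delta>"
  by (intro half_dom T_properties)

text \<open>Along a curve the lower components are holomorphic coefficients, and the equation for
  the next one has the single parameter \<open>l\<close>. \<open>holomorphic_implicit\<close> then
  applies on the full neighbourhood of radius \<open>\<delta> ?n\<close>, with expansion
  \<open>q / 2\<close> from \<open>H_lower\<close>.\<close>

lemma curve_holomorphic_T:
  "k \<le> d \<Longrightarrow> curve_holomorphic (\<lambda>z. T k z i) (poly_dom k \<zeta>)"
proof (induction k arbitrary: i)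
  case 0
  then show ?case by (simp add: curve_holomorphic_def)
next
  case (Suc k)
  let ?n = "Suc k"
  have n: "?n \<in> {1..d}" using Suc.prems by auto
  have IH: "curve_holomorphic (\<lambda>z. T k z i) (poly_dom k \<zeta>)" for i using Suc by auto
  have IH': "curve_holomorphic (\<lambda>z. T k z i) (poly_dom ?n \<zeta>)" for i
    using IH by (rule curve_holomorphic_subset) (auto intro: poly_dom_mono)
  show ?case
  proof (cases "i = ?n")
    case False
    then show ?thesis using IH'[of i] by simp
  next
    case True
    show ?thesis
      unfolding curve_holomorphic_def True
    proof (intro allI impI)
      fix \<gamma> :: "complex \<Rightarrow> nat \<Rightarrow> complex" and W :: "complex set"
      assume W: "open W" and hol: "\<forall>i. (\<lambda>l. \<gamma> l i) holomorphic_on W" and U: "\<forall>l\<in>W. \<gamma> l \<in> poly_dom ?n \<zeta>"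
      let ?V = "nbhd (\<delta> ?n) cinterval"
      have d: "0 < \<delta> ?n" using rho.\<delta>_pos[OF n] .
      have Tk: "T k (\<gamma> l) \<in> poly_dom (?n - 1) \<delta>" if "l \<in> W" for l
        using T_in_dom[of k "\<gamma> l"] poly_dom_mono[of "\<gamma> l" ?n \<zeta> k] Suc.prems U that by auto
      have \<gamma>n: "\<gamma> l \<in> poly_dom ?n \<delta>" if "l \<in> W" for l using U that Suc.prems by (intro \<zeta>_dom) auto
      have \<gamma>k: "\<gamma> l \<in> poly_dom (?n - 1) \<delta>" if "l \<in> W" for l using poly_dom_mono[OF \<gamma>n[OF that]] by simp
      have \<gamma>nn: "\<gamma> l ?n \<in> ?V" if "l \<in> W" for l using \<gamma>n[OF that] by (auto simp: poly_dom_def)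
      have line: "(\<lambda>l. ((T k (\<gamma> l))(?n := s)) i) holomorphic_on W" for s i
        using curve_holomorphicD[OF IH' W, of \<gamma> i] hol U by (cases "i = ?n") auto
      show "(\<lambda>l. T ?n (\<gamma> l) ?n) holomorphic_on W"
      proof (rule holomorphic_implicit[where V = ?V and c = "q / 2"
            and E = "\<lambda>l s. pi.H ?n ((T k (\<gamma> l))(?n := s)) - rho.H ?n (\<gamma> l)"
            and e = "\<lambda>l s. pi.cnd ?n ((T k (\<gamma> l))(?n := s))"
            and B = "2 / q * (2 + \<delta> ?n) + 2 / q * (2 + \<delta> ?n)", OF W open_nbhd])
        fix l assume l: "l \<in> W"
        have "T ?n (\<gamma> l) \<in> poly_dom ?n \<delta>" using Suc.prems U l by (intro T_in_dom) auto
        then show "T ?n (\<gamma> l) ?n \<in> ?V" by (rule poly_domD) simp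
        show "pi.H ?n ((T k (\<gamma> l))(?n := T ?n (\<gamma> l) ?n)) - rho.H ?n (\<gamma> l) = 0"
          using T_properties(2)[of ?n "\<gamma> l"] T_upd[of ?n "\<gamma> l"] Suc.prems U l by simp
      next
        fix s assume s: "s \<in> ?V"
        have dom: "(T k (\<gamma> l))(?n := s) \<in> poly_dom ?n \<delta>" if "l \<in> W" for l
          by (rule rho.upd_in_dom[OF Tk[OF that] s])
        show "(\<lambda>l. pi.H ?n ((T k (\<gamma> l))(?n := s)) - rho.H ?n (\<gamma> l)) holomorphic_on W"
          using hol by (intro holomorphic_on_diff curve_holomorphicD[OF pi.curve_holomorphic_H[OF n] W line dom]
              curve_holomorphicD[OF rho.curve_holomorphic_H[OF n] W _ \<gamma>n]) auto
        show "(\<lambda>l. pi.cnd ?n ((T k (\<gamma> l))(?n := s))) holomorphic_on W"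
          using Suc.prems by (intro curve_holomorphicD[OF pi.curve_holomorphic_cnd W line dom])
      next
        fix l s assume l: "l \<in> W" and s: "s \<in> ?V"
        show "((\<lambda>s. pi.H ?n ((T k (\<gamma> l))(?n := s)) - rho.H ?n (\<gamma> l)) has_field_derivative
           pi.cnd ?n ((T k (\<gamma> l))(?n := s))) (at s)"
          using pi.H_deriv[OF n Tk[OF l] s] by (auto intro!: derivative_eq_intros)
        have "cmod (rho.H ?n ((\<gamma> l)(?n := \<gamma> l ?n))) \<le> 2 / q * (2 + \<delta> ?n)"
          by (rule rho.H_bound[OF n \<gamma>k[OF l] \<gamma>nn[OF l]])
        then show "cmod (pi.H ?n ((T k (\<gamma> l))(?n := s)) - rho.H ?n (\<gamma> l)) \<le> 2 / q * (2 + \<delta> ?n) + 2 / q * (2 + \<delta> ?n)"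
          using pi.H_bound(2)[OF n Tk[OF l] s] unfolding fun_upd_triv by (metis add_mono norm_triangle_ineq4 order_trans)
        show "pi.cnd ?n ((T k (\<gamma> l))(?n := s)) \<noteq> 0"
          by (intro pi.cnd_nonzero n pi.upd_in_dom Tk l s)
        show "q / 2 * cmod (s - s') \<le> cmod (pi.H ?n ((T k (\<gamma> l))(?n := s)) - rho.H ?n (\<gamma> l)
            - (pi.H ?n ((T k (\<gamma> l))(?n := s')) - rho.H ?n (\<gamma> l)))" if "s' \<in> ?V" for s'
          using pi.H_lower[OF n Tk[OF l] s that] by simp
      qed (use rho.q_pos in auto)
    qed
  qed
qed

section \<open>Agreement with the real transport\<close>

lemma \<zeta>_pos: "j \<in> {1..d} \<Longrightarrow> 0 < \<zeta> j"
  using rho.\<delta>_pos[of j] rho.q_pos by (simp add: \<zeta>_def)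

lemma real_in_\<zeta>_dom:
  assumes "k \<le> d" "\<And>i. i \<in> {1..k} \<Longrightarrow> x i \<in> {-1..1}" "\<And>i. i \<in> {1..k} \<Longrightarrow> z i = complex_of_real (x i)"
  shows "z \<in> poly_dom k \<zeta>"
  unfolding poly_dom_def using assms \<zeta>_pos by (auto intro!: of_real_in_nbhd)

text \<open>\<open>KR\<close> inverts on the real interval, \<open>T\<close> chooses in a complex
  neighbourhood; both solve the same equation, and \<open>root_unique\<close> identifies them. Only
  the coordinates up to \<open>k\<close> of \<open>z\<close> are prescribed, so that vectors made by
  \<open>embed\<close> and their prefixes both qualify.\<close>

lemma T_real:
  assumes "k \<le> d" "\<And>i. i \<in> {1..k} \<Longrightarrow> x i \<in> {-1..1}" "\<And>i. i \<in> {1..k} \<Longrightarrow> z i = complex_of_real (x i)"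
    and "i \<in> {1..k}"
  shows "T k z i = of_real (KR d f g i x) \<and> KR d f g i x \<in> {-1..1}"
  using assms
proof (induction k arbitrary: i)
  case (Suc k)
  let ?n = "Suc k"
  have n: "?n \<in> {1..d}" using Suc.prems by auto
  have IH: "T k z i = of_real (KR d f g i x) \<and> KR d f g i x \<in> {-1..1}" if "i \<in> {1..k}" for i
    using Suc.prems(1-3) that by (intro Suc.IH) auto
  show ?case
  proof (cases "i = ?n")
    case False
    then show ?thesis using IH[of i] Suc.prems(4) by auto
  next
    case True
    \<comment> \<open>The argument of \<open>cond_cdf\<close> in \<open>KR.simps\<close>, equal to
      \<open>t\<close> in all coordinates from \<open>?n\<close> on, of which only coordinate
      \<open>?n\<close> is read.\<close>
    define y where "y t = (\<lambda>i. if i < ?n then KR d f g i x else t)" for t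
    have yI: "y t i \<in> {-1..1}" if "i \<in> {1..?n}" "t \<in> {-1..1}" for t i
      using IH[of i] that by (auto simp: y_def)
    have z\<zeta>: "z \<in> poly_dom ?n \<zeta>" by (rule real_in_\<zeta>_dom[OF Suc.prems(1-3)])
    have Tk: "T k z \<in> poly_dom (?n - 1) \<delta>"
      using T_in_dom[of k z] Suc.prems(1) poly_dom_mono[OF z\<zeta>] by auto
    have a: "rho.H ?n z = of_real (cond_cdf d f ?n x)"
      using rho.H_real[OF n Suc.prems(2)] rho.H_cong[of ?n z "\<lambda>i. of_real (x i)"] Suc.prems(3) by auto
    have Hy: "pi.H ?n ((T k z)(?n := of_real t)) = of_real (cond_cdf d g ?n (y t))" if "t \<in> {-1..1}" for t
    proof -
      have "pi.H ?n ((T k z)(?n := of_real t)) = pi.H ?n (\<lambda>i. of_real (y t i))"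
        using IH by (intro pi.H_cong) (auto simp: y_def)
      also have "\<dots> = of_real (cond_cdf d g ?n (y t))" using that by (intro pi.H_real[OF n] yI)
      finally show ?thesis .
    qed
    obtain s where s: "s \<in> {-1..1}"
      "pi.H ?n ((\<lambda>i. of_real (y 0 i))(?n := complex_of_real s)) = rho.H ?n (\<lambda>i. of_real (x i))"
    proof (rule real_root[of ?n x "y 0", OF n Suc.prems(2)])
      show "y 0 i \<in> {-1..1}" if "i \<in> {1..?n - 1}" for i using yI[of i 0] that by auto
    qed (use that in auto)
    have "pi.H ?n ((\<lambda>i. of_real (y 0 i))(?n := complex_of_real s)) = pi.H ?n ((T k z)(?n := of_real s))"
      using IH by (intro pi.H_cong) (auto simp: y_def)
    moreover have "rho.H ?n (\<lambda>i. of_real (x i)) = rho.H ?n z"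
      using Suc.prems(3) by (intro rho.H_cong) auto
    ultimately have "complex_of_real (cond_cdf d g ?n (y s)) = of_real (cond_cdf d f ?n x)"
      using s a Hy[OF s(1)] by simp
    \<comment> \<open>Membership in the image makes \<open>inv_into\<close> a genuine preimage
      instead of an arbitrary value.\<close>
    then have im: "cond_cdf d f ?n x \<in> (\<lambda>t. cond_cdf d g ?n (y t)) ` {-1..1}"
      using s(1) by (intro image_eqI[of _ _ s]) simp_all
    have KR: "KR d f g ?n x = inv_into {-1..1} (\<lambda>t. cond_cdf d g ?n (y t)) (cond_cdf d f ?n x)"
      unfolding y_def by (rule KR.simps)
    have r: "KR d f g ?n x \<in> {-1..1}" unfolding KR using im by (rule inv_into_into)
    have "cond_cdf d g ?n (y (KR d f g ?n x)) = cond_cdf d f ?n x"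
      unfolding KR using im by (rule f_inv_into_f)
    then have eq: "pi.H ?n ((T k z)(?n := of_real (KR d f g ?n x))) = pi.H ?n ((T k z)(?n := T ?n z ?n))"
      using Hy[OF r] a T_properties(2)[OF Suc.prems(1) z\<zeta>] T_upd[of ?n z] by simp
    have "T ?n z ?n \<in> nbhd (\<delta> ?n) cinterval"
      using T_in_dom[OF Suc.prems(1) z\<zeta>] by (rule poly_domD) simp
    from root_unique[OF n Tk rho.of_real_in_nbhd'[OF n r] this eq]
    show ?thesis using r True by simp
  qed
qed simp

section \<open>The derivative of the transport\<close>

definition R :: "nat \<Rightarrow> (nat \<Rightarrow> complex) \<Rightarrow> complex" where
  "R k z = rho.cnd k z / pi.cnd k (T k z)"

text \<open>The components below \<open>k\<close> do not depend on coordinate \<open>k\<close>, so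
  differentiating the defining equation in that coordinate touches only the last slot of
  \<open>pi.H\<close>; dividing by the nonzero conditional gives \<open>R\<close>.\<close>

lemma T_has_derivative:
  assumes k: "k \<in> {1..d}" and z: "z \<in> poly_dom k \<zeta>"
  shows "((\<lambda>s. T k (z(k := s)) k) has_field_derivative R k z) (at (z k))"
proof -
  let ?V = "nbhd (\<zeta> k) cinterval"
  define S where "S s = T k (z(k := s)) k" for s
  define w where "w = T (k - 1) z"
  have k': "k \<le> d" "1 \<le> k" using k by auto
  have zk: "z k \<in> ?V" using z k by (auto simp: poly_dom_def)
  have z': "z \<in> poly_dom (k - 1) \<zeta>" using z by (rule poly_dom_mono) simp
  have zd: "z(k := s) \<in> poly_dom k \<zeta>" if "s \<in> ?V" for s using rho.upd_in_dom[OF z' that] .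
  have w: "w \<in> poly_dom (k - 1) \<delta>" unfolding w_def using k' z' by (intro T_in_dom) auto
  have Tk: "T k (z(k := s)) = w(k := S s)" for s
  proof -
    have "T (k - 1) (z(k := s)) = w" unfolding w_def by (rule T_cong) auto
    then show ?thesis using T_upd[OF k'(2), of "z(k := s)"] by (simp add: S_def)
  qed
  have "S holomorphic_on ?V"
    unfolding S_def using zd by (intro curve_holomorphic_line[OF curve_holomorphic_T[OF k'(1)] open_nbhd])
  then have dS: "(S has_field_derivative deriv S (z k)) (at (z k))"
    using open_nbhd zk by (rule holomorphic_derivI)
  have "T k (z(k := z k)) \<in> poly_dom k \<delta>" using zd[OF zk] k' by (intro T_in_dom)
  then have Sk: "S (z k) \<in> nbhd (\<delta> k) cinterval" using k unfolding S_def poly_dom_def by auto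
  have "((\<lambda>s. pi.H k (w(k := S s))) has_field_derivative pi.cnd k (w(k := S (z k))) * deriv S (z k)) (at (z k))"
    using pi.H_deriv[OF k w Sk] dS by (rule DERIV_chain2)
  note dA = this
  have "pi.H k (w(k := S s)) = rho.H k (z(k := s))" if "s \<in> ?V" for s
    using T_properties(2)[OF k'(1) zd[OF that] k'(2)] unfolding Tk .
  from has_field_derivative_transform_within_open[OF dA open_nbhd zk this]
  have "((\<lambda>s. rho.H k (z(k := s))) has_field_derivative pi.cnd k (w(k := S (z k))) * deriv S (z k)) (at (z k))" .
  moreover have "((\<lambda>s. rho.H k (z(k := s))) has_field_derivative rho.cnd k (z(k := z k))) (at (z k))"
    using \<zeta>_dom[OF k'(1) z] k by (intro rho.H_deriv[OF k \<zeta>_dom[OF _ z']]) (auto simp: poly_dom_def)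
  ultimately have "pi.cnd k (w(k := S (z k))) * deriv S (z k) = rho.cnd k z"
    using DERIV_unique by fastforce
  moreover have "pi.cnd k (w(k := S (z k))) \<noteq> 0"
    using w Sk by (intro pi.cnd_nonzero[OF k] pi.upd_in_dom)
  moreover have "w(k := S (z k)) = T k z" using Tk[of "z k"] by simp
  ultimately have "deriv S (z k) = R k z" by (auto simp: R_def field_simps)
  with dS show ?thesis by (simp add: S_def[abs_def])
qed

lemma curve_holomorphic_R:
  assumes k: "k \<in> {1..d}"
  shows "curve_holomorphic (R k) (poly_dom k \<zeta>)"
proof -
  have k': "k \<le> d" using k by auto
  have "curve_holomorphic (\<lambda>z. pi.cnd k (T k z)) (poly_dom k \<zeta>)"
    unfolding curve_holomorphic_def
  proof (intro allI impI)
    fix \<gamma> :: "complex \<Rightarrow> nat \<Rightarrow> complex" and W :: "complex set"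
    assume *: "open W" "\<forall>i. (\<lambda>l. \<gamma> l i) holomorphic_on W" "\<forall>l\<in>W. \<gamma> l \<in> poly_dom k \<zeta>"
    show "(\<lambda>l. pi.cnd k (T k (\<gamma> l))) holomorphic_on W"
    proof (rule curve_holomorphicD[where \<gamma> = "\<lambda>l. T k (\<gamma> l)", OF pi.curve_holomorphic_cnd[OF k'] *(1)])
      show "(\<lambda>l. T k (\<gamma> l) i) holomorphic_on W" for i
        using * by (intro curve_holomorphicD[where \<gamma> = \<gamma>, OF curve_holomorphic_T[OF k']]) auto
    qed (use T_in_dom[OF k'] * in auto)
  qed
  moreover have "curve_holomorphic (rho.cnd k) (poly_dom k \<zeta>)"
    using rho.curve_holomorphic_cnd[OF k'] by (rule curve_holomorphic_subset) (auto intro: \<zeta>_dom[OF k'])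
  ultimately show ?thesis
    unfolding R_def[abs_def] using T_in_dom[OF k'] pi.cnd_nonzero[OF k] by (intro curve_holomorphic_divide) auto
qed

text \<open>Lower bounds for the real parts of numerator and denominator do not control the real
  part of a quotient. It is therefore compared with the quotient \<open>r / s\<close> of real
  conditionals, which is at least \<open>q ^ 2\<close>.\<close>

lemma R_bounds:
  assumes k: "k \<in> {1..d}" and z: "z \<in> poly_dom k \<zeta>"
  shows "cmod (R k z) \<le> 4 / q\<^sup>2" "q\<^sup>2 / 2 \<le> Re (R k z)"
proof -
  have k': "k \<le> d" using k by auto
  define a b where "a = rho.cnd k z" and "b = pi.cnd k (T k z)"
  have zd: "z \<in> poly_dom k \<delta>" "T k z \<in> poly_dom k \<delta>"
    using \<zeta>_dom[OF k' z] T_in_dom[OF k' z] by auto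
  have b: "q / 2 \<le> cmod b" and nb: "cmod a \<le> 2 / q"
    using pi.cnd_bounds(1)[OF k zd(2)] rho.cnd_bounds(2)[OF k zd(1)] complex_Re_le_cmod[of b]
    by (simp_all add: a_def b_def)
  have q: "0 < q" using rho.q_pos .
  have "cmod a / cmod b \<le> (2 / q) / (q / 2)" using b nb q by (intro frac_le) auto
  also have "\<dots> = 4 / q\<^sup>2" by (simp add: power2_eq_square)
  finally show "cmod (R k z) \<le> 4 / q\<^sup>2" by (simp add: R_def a_def b_def norm_divide)
  obtain x where x: "\<And>i. i \<in> {1..k} \<Longrightarrow> x i \<in> {-1..1}" "\<And>i. i \<in> {1..k} \<Longrightarrow> cmod (z i - of_real (x i)) < \<delta> i"
    using poly_dom_realE[OF zd(1)] by metis
  \<comment> \<open>Any real point near \<open>T k z\<close> will do, not the transport of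
    \<open>x\<close>: the bounds \<open>q\<close> and \<open>1 / q\<close> hold for the conditional
    at every real point.\<close>
  obtain y where y: "\<And>i. i \<in> {1..k} \<Longrightarrow> y i \<in> {-1..1}" "\<And>i. i \<in> {1..k} \<Longrightarrow> cmod (T k z i - of_real (y i)) < \<delta> i"
    using poly_dom_realE[OF zd(2)] by metis
  define r where "r = conditional d f k x"
  define s where "s = conditional d g k y"
  have r: "q \<le> r" "r \<le> 1 / q" and s: "q \<le> s" "s \<le> 1 / q"
    unfolding r_def s_def using rho.cnd_real(2,3)[OF k x(1)] pi.cnd_real(2,3)[OF k y(1)] by auto
  have ar: "cmod (a - of_real r) \<le> rho.\<theta>"
    using rho.cnd_close[of k x z, OF k x] rho.cnd_real(1)[of k x, OF k x(1)] by (simp add: a_def r_def)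
  have bs: "cmod (b - of_real s) \<le> rho.\<theta>"
    using pi.cnd_close[of k y "T k z", OF k y] pi.cnd_real(1)[of k y, OF k y(1)] by (simp add: b_def s_def)
  have nz: "b \<noteq> 0" "s \<noteq> 0" using b s q by auto
  have "a / b - of_real (r / s) = ((a - of_real r) * of_real s - of_real r * (b - of_real s)) / (b * of_real s)"
    using nz by (simp add: field_simps)
  also have "cmod \<dots> = cmod ((a - of_real r) * of_real s - of_real r * (b - of_real s)) / (cmod b * s)"
    using s q by (simp add: norm_divide norm_mult)
  also have "\<dots> \<le> (rho.\<theta> * (1 / q) + (1 / q) * rho.\<theta>) / ((q / 2) * q)"
  proof (rule frac_le)
    have "cmod ((a - of_real r) * of_real s - of_real r * (b - of_real s)) \<le> cmod (a - of_real r) * s + r * cmod (b - of_real s)"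
      using r s q norm_triangle_ineq4[of "(a - of_real r) * of_real s" "of_real r * (b - of_real s)"] by (simp add: norm_mult)
    also have "\<dots> \<le> rho.\<theta> * (1 / q) + (1 / q) * rho.\<theta>"
      using ar bs r s q rho.\<theta>_pos by (intro add_mono mult_mono) auto
    finally show "cmod ((a - of_real r) * of_real s - of_real r * (b - of_real s)) \<le> rho.\<theta> * (1 / q) + (1 / q) * rho.\<theta>" .
    show "(q / 2) * q \<le> cmod b * s" using b s q by (intro mult_mono) auto
  qed (use q rho.\<theta>_pos in auto)
  also have "\<dots> = q\<^sup>2 / 32" using q by (simp add: rho.\<theta>_def field_simps power_numeral_reduce)
  finally have "cmod (a / b - of_real (r / s)) \<le> q\<^sup>2 / 32" .
  then have "\<bar>Re (a / b) - r / s\<bar> \<le> q\<^sup>2 / 32"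
    using abs_Re_le_cmod[of "a / b - of_real (r / s)"] unfolding minus_complex.sel Re_complex_of_real by linarith
  moreover have "q / (1 / q) \<le> r / s" using r s q by (intro frac_le) auto
  then have "q\<^sup>2 \<le> r / s" by (simp add: power2_eq_square)
  moreover have "0 < q\<^sup>2" using q by simp
  ultimately show "q\<^sup>2 / 2 \<le> Re (R k z)" unfolding R_def a_def[symmetric] b_def[symmetric] by linarith
qed

text \<open>The numerator is at a real last coordinate, where \<open>cnd_near_1\<close> applies. The
  denominator is at \<open>S\<close>, which may be complex, so it is first compared with its value
  at -1; this preserves the decay in \<open>\<delta> k\<close> only if the distance from
  \<open>S\<close> to -1 has a bound free of \<open>\<delta> k\<close>.\<close>

lemma R_near_1:
  assumes k: "k \<in> {1..d}" and z: "z \<in> poly_dom k \<zeta>" and s: "z k = of_real s" "s \<in> {-1..1}"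
  shows "cmod (R k z - 1) \<le> 192 / (q ^ 4 * \<delta> k)"
proof -
  have k': "k \<le> d" "1 \<le> k" using k by auto
  have q: "0 < q" "q \<le> 1" using rho.q_pos rho.q_le_1 by auto
  have d: "0 < \<delta> k" using rho.\<delta>_pos[OF k] .
  define w where "w = T (k - 1) z"
  define S where "S = T k z k"
  have Tk: "T k z = w(k := S)" using T_upd[OF k'(2), of z] by (simp add: w_def S_def)
  have zz: "z = z(k := of_real s)" using s(1) by auto
  have z\<delta>: "z \<in> poly_dom (k - 1) \<delta>" using poly_dom_mono[OF \<zeta>_dom[OF k'(1) z]] by simp
  have w: "w \<in> poly_dom (k - 1) \<delta>"
    unfolding w_def using k' poly_dom_mono[OF z] by (intro T_in_dom) auto
  have S2: "S \<in> nbhd (\<delta> k / 2) cinterval"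
    using T_properties(1)[OF k'(1) z] k unfolding S_def poly_dom_def by auto
  then have S1: "S \<in> nbhd (\<delta> k) cinterval" using nbhd_mono[of "\<delta> k / 2" "\<delta> k"] d by auto
  have a: "cmod (rho.cnd k z - 1) \<le> 16 / (q * \<delta> k)"
    using rho.cnd_near_1[OF k z\<delta> s(2)] zz by simp
  have m: "- 1 \<in> nbhd (\<delta> k) cinterval" "- 1 \<in> nbhd (\<delta> k / 2) cinterval"
    using d by (auto intro!: minus_one_in_nbhd)
  \<comment> \<open>Membership in the half neighbourhood would allow a distance growing with
    \<open>\<delta> k\<close>. The equation for \<open>S\<close> does better: its right-hand side is
    at most \<open>4 / q\<close> for real \<open>s\<close>, and the expansion of \<open>pi.H\<close>
    turns this into \<open>8 / q ^ 2\<close>.\<close>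
  have "q / 2 * cmod (S + 1) \<le> cmod (pi.H k (w(k := S)))"
    using pi.H_lower[OF k w S1 m(1)] by (simp add: pi.H_start)
  also have "\<dots> = cmod (rho.H k (z(k := of_real s)))"
    using T_properties(2)[OF k'(1) z k'(2)] zz unfolding Tk by simp
  also have "\<dots> \<le> 2 / q * cmod (of_real s + 1)"
    by (intro rho.H_bound(1)[OF k z\<delta>] rho.of_real_in_nbhd' k s(2))
  also have "cmod (of_real s + 1) \<le> 2"
    using s(2) norm_of_real[of "s + 1", where ?'a = complex] by simp
  then have "2 / q * cmod (of_real s + 1) \<le> 2 / q * 2" using q by (intro mult_left_mono) auto
  finally have Sm: "cmod (S + 1) \<le> 8 / q\<^sup>2" using q by (simp add: field_simps power2_eq_square)
  have "cmod (pi.cnd k (w(k := S)) - pi.cnd k (w(k := -1))) \<le> 8 / (q * \<delta> k) * cmod (S - (-1))"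
    by (rule pi.cnd_lipschitz[OF k w S2 m(2)])
  also have "\<dots> \<le> 8 / (q * \<delta> k) * (8 / q\<^sup>2)" using Sm q d by (intro mult_left_mono) auto
  finally have b1: "cmod (pi.cnd k (w(k := S)) - pi.cnd k (w(k := -1))) \<le> 8 / (q * \<delta> k) * (8 / q\<^sup>2)" .
  have b2: "cmod (pi.cnd k (w(k := -1)) - 1) \<le> 16 / (q * \<delta> k)"
    using pi.cnd_near_1[OF k w, of "-1"] by simp
  have b: "cmod (pi.cnd k (T k z) - 1) \<le> 8 / (q * \<delta> k) * (8 / q\<^sup>2) + 16 / (q * \<delta> k)"
    using norm_triangle_mono[OF b1 b2] by (simp add: Tk)
  have "cmod (1 - pi.cnd k (T k z)) \<le> 8 / (q * \<delta> k) * (8 / q\<^sup>2) + 16 / (q * \<delta> k)"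
    using b by (simp add: norm_minus_commute)
  from norm_triangle_mono[OF a this]
  have "cmod (rho.cnd k z - pi.cnd k (T k z)) \<le> 16 / (q * \<delta> k) + (8 / (q * \<delta> k) * (8 / q\<^sup>2) + 16 / (q * \<delta> k))"
    by simp
  also have "\<dots> = (32 * q\<^sup>2 + 64) / (q ^ 3 * \<delta> k)"
    using q d by (simp add: field_simps power_numeral_reduce)
  also have "\<dots> \<le> 96 / (q ^ 3 * \<delta> k)"
    using q d power_le_one[of q 2] by (intro divide_right_mono) auto
  finally have ab: "cmod (rho.cnd k z - pi.cnd k (T k z)) \<le> 96 / (q ^ 3 * \<delta> k)" .
  have bq: "q / 2 \<le> cmod (pi.cnd k (T k z))"
    using pi.cnd_bounds(1)[OF k T_in_dom[OF k'(1) z]] complex_Re_le_cmod[of "pi.cnd k (T k z)"] by simp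
  then have "pi.cnd k (T k z) \<noteq> 0" using q by auto
  then have "R k z - 1 = (rho.cnd k z - pi.cnd k (T k z)) / pi.cnd k (T k z)"
    by (simp add: R_def diff_divide_distrib)
  also have "cmod \<dots> \<le> (96 / (q ^ 3 * \<delta> k)) / (q / 2)"
    unfolding norm_divide using ab bq q d by (intro frac_le) auto
  also have "\<dots> = 192 / (q ^ 4 * \<delta> k)" using q d by (simp add: field_simps power_numeral_reduce)
  finally show ?thesis .
qed

text \<open>At a real point both conditionals are real, hence so is \<open>R\<close>. The complex
  derivative restricts to the real line, and taking real parts yields the derivative of
  \<open>KR\<close>.\<close>

lemma KR_has_derivative:
  assumes k: "k \<in> {1..d}" and x: "x \<in> cube k"
  obtains D where "((\<lambda>t. KR d f g k (x(k := t))) has_vector_derivative D) (at (x k) within {-1..1})"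
    "R k (embed k x) = of_real D"
proof -
  have k': "k \<le> d" using k by auto
  have xI: "x i \<in> {-1..1}" if "i \<in> {1..k}" for i using x that by (auto simp: cube_def PiE_iff)
  define z where "z = embed k x"
  have zx: "z i = of_real (x i)" if "i \<in> {1..k}" for i using that by (simp add: z_def embed_def)
  have z: "z \<in> poly_dom k \<zeta>" using k' xI zx by (rule real_in_\<zeta>_dom)
  have xk: "x k \<in> {-1..1}" "z k = of_real (x k)" using xI zx k by auto
  have Tz: "T k z i = of_real (KR d f g i x)" "KR d f g i x \<in> {-1..1}" if "i \<in> {1..k}" for i
    using T_real[of k x z i, OF k' xI zx that] by auto
  have "pi.cnd k (T k z) = pi.cnd k (\<lambda>i. of_real (KR d f g i x))"
    using k Tz(1) by (intro pi.cnd_cong) auto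
  also have "\<dots> = of_real (conditional d g k (\<lambda>i. KR d f g i x))"
    using Tz(2) by (intro pi.cnd_real(1)[OF k])
  finally have c2: "pi.cnd k (T k z) = of_real (conditional d g k (\<lambda>i. KR d f g i x))" .
  have "rho.cnd k z = rho.cnd k (\<lambda>i. of_real (x i))"
    using k zx by (intro rho.cnd_cong) auto
  also have "\<dots> = of_real (conditional d f k x)" using xI by (intro rho.cnd_real(1)[OF k])
  finally have c1: "rho.cnd k z = of_real (conditional d f k x)" .
  define D where "D = conditional d f k x / conditional d g k (\<lambda>i. KR d f g i x)"
  have RD: "R k z = of_real D" by (simp add: R_def c1 c2 D_def)
  have "((\<lambda>s. T k (z(k := s)) k) has_field_derivative of_real D) (at (of_real (x k)))"
    using T_has_derivative[OF k z] RD xk(2) by simp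
  then have "((\<lambda>t. T k (z(k := of_real t)) k) has_vector_derivative of_real D) (at (x k) within {-1..1})"
    using has_vector_derivative_real_field[of "\<lambda>s. T k (z(k := s)) k" "of_real D" "x k"] by simp
  then have "((\<lambda>t. Re (T k (z(k := of_real t)) k)) has_vector_derivative Re (of_real D)) (at (x k) within {-1..1})"
    by (rule bounded_linear.has_vector_derivative[OF bounded_linear_Re])
  note dT = this
  \<comment> \<open>\<open>T_real\<close> covers \<open>t\<close> in the interval only, which is why
    the derivative is one-sided at the endpoints.\<close>
  have "KR d f g k (x(k := t)) = Re (T k (z(k := of_real t)) k)" if t: "t \<in> {-1..1}" for t
  proof -
    have "T k (z(k := of_real t)) k = of_real (KR d f g k (x(k := t)))
        \<and> KR d f g k (x(k := t)) \<in> {-1..1}"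
      using xI zx t k by (intro T_real[OF k']) auto
    then show ?thesis by simp
  qed
  from has_vector_derivative_transform[OF xk(1) this dT]
  have "((\<lambda>t. KR d f g k (x(k := t))) has_vector_derivative D) (at (x k) within {-1..1})" by simp
  with RD that show ?thesis unfolding z_def by blast
qed

lemma KR_differentiable:
  assumes "k \<in> {1..d}" "x \<in> cube k"
  shows "(\<lambda>t. KR d f g k (x(k := t))) differentiable (at (x k) within {-1..1})"
  using KR_has_derivative[OF assms] by (metis differentiableI_vector)

lemma R_eq_KR_deriv:
  assumes k: "k \<in> {1..d}" and x: "x \<in> cube k"
  shows "R k (embed k x) = of_real (KR_deriv d f g k x)"
proof -
  obtain D where D: "((\<lambda>t. KR d f g k (x(k := t))) has_vector_derivative D) (at (x k) within {-1..1})"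
    "R k (embed k x) = of_real D" using KR_has_derivative[OF assms] by metis
  have "x k \<in> {-1..1}" using k x by (auto simp: cube_def PiE_iff)
  then have "KR_deriv d f g k x = D"
    unfolding KR_deriv_def using D(1) vector_derivative_within_cbox[of "-1" 1 "x k"] by auto
  with D(2) show ?thesis by simp
qed

text \<open>The return from curves to Frechet derivatives, made possible by the uniform bound on
  \<open>R\<close>.\<close>

lemma holomorphic_extension_R:
  assumes k: "k \<in> {1..d}"
  shows "holomorphic_extension k (KR_deriv d f g k) (R k) (poly_nbhd k \<zeta> cinterval)"
  unfolding holomorphic_extension_def
  using curve_holomorphic_imp_nvar[OF curve_holomorphic_R[OF k] R_bounds(1)[OF k]] R_eq_KR_deriv[OF k] by blast

text \<open>The 200 is dictated by (ii), where 192 arises; a crude \<open>5 / q ^ 4\<close> fits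
  below it.\<close>

lemma norm_R_minus_1_less:
  assumes "k \<in> {1..d}" "z \<in> poly_dom k \<zeta>"
  shows "cmod (R k z - 1) < 200 / q ^ 4"
proof -
  have q: "0 < q" "q \<le> 1" using rho.q_pos rho.q_le_1 by auto
  have q42: "q ^ 4 \<le> q\<^sup>2" "q ^ 4 \<le> 1" using q by (auto intro!: power_decreasing power_le_one)
  have "cmod (R k z - 1) \<le> cmod (R k z) + cmod 1" by (rule norm_triangle_ineq4)
  also have "\<dots> \<le> 4 / q\<^sup>2 + 1" using R_bounds(1)[OF assms] by simp
  also have "\<dots> \<le> 4 / q ^ 4 + 1 / q ^ 4" using q q42 by (intro add_mono divide_left_mono) auto
  also have "\<dots> < 200 / q ^ 4" using q by (simp flip: add_divide_distrib add: divide_strict_right_mono)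
  finally show ?thesis .
qed

lemma Re_R_ge:
  assumes "k \<in> {1..d}" "z \<in> poly_dom k \<zeta>"
  shows "1 / (200 / q ^ 4) \<le> Re (R k z)"
proof -
  have "q ^ 4 \<le> q\<^sup>2" using rho.q_pos rho.q_le_1 by (intro power_decreasing) auto
  moreover have "0 < q\<^sup>2" using rho.q_pos by simp
  ultimately have "q ^ 4 / 200 \<le> Re (R k z)" using R_bounds(2)[OF assms] by linarith
  then show ?thesis by simp
qed

text \<open>For \<open>\<delta> k \<le> 1\<close> the maximum is 1 and the bound of (i) is the
  claim; otherwise \<open>R_near_1\<close> applies, and 192 < 200 gives strictness.\<close>

lemma R_near_1_strict:
  assumes k: "k \<in> {1..d}" and z: "z \<in> poly_dom k \<zeta>" and s: "z k \<in> cinterval"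
  shows "cmod (R k z - 1) < 200 / q ^ 4 / max 1 (\<delta> k)"
proof (cases "\<delta> k \<le> 1")
  case True
  then show ?thesis using norm_R_minus_1_less[OF k z] by simp
next
  case False
  obtain t where t: "z k = of_real t" "t \<in> {-1..1}" using s by (auto simp: cinterval_def)
  have "cmod (R k z - 1) \<le> 192 / (q ^ 4 * \<delta> k)" by (rule R_near_1[OF k z t])
  also have "\<dots> < 200 / (q ^ 4 * \<delta> k)" using False rho.q_pos by (intro divide_strict_right_mono) auto
  finally show ?thesis using False by simp
qed

end

theorem theorem3p6:
  fixes M L :: real
  assumes "0 < M" and "M \<le> L"
  shows "\<exists>C6>0. \<exists>C7>0. \<exists>C8>0. \<forall>(d::nat) (\<delta> :: nat \<Rightarrow> real).
    (\<forall>j\<in>{1..d}. 0 < \<delta> j) \<longrightarrow>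
    (\<forall>(\<rho> :: (nat \<Rightarrow> real) measure) (\<pi> :: (nat \<Rightarrow> real) measure)
      (f\<^sub>\<rho> :: (nat \<Rightarrow> real) \<Rightarrow> real) (f\<^sub>\<pi> :: (nat \<Rightarrow> real) \<Rightarrow> real)
      (F\<^sub>\<rho> :: (nat \<Rightarrow> complex) \<Rightarrow> complex) (F\<^sub>\<pi> :: (nat \<Rightarrow> complex) \<Rightarrow> complex).
      \<rho> = density (cube_measure d) (\<lambda>x. ennreal (f\<^sub>\<rho> x)) \<longrightarrow>
      \<pi> = density (cube_measure d) (\<lambda>x. ennreal (f\<^sub>\<pi> x)) \<longrightarrow>
      prob_space \<rho> \<longrightarrow> prob_space \<pi> \<longrightarrow>
      admissible_density d \<delta> M L C6 f\<^sub>\<rho> F\<^sub>\<rho> \<longrightarrow>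
      admissible_density d \<delta> M L C6 f\<^sub>\<pi> F\<^sub>\<pi> \<longrightarrow>
      (\<forall>k\<in>{1..d}.
        (\<forall>x\<in>cube k. (\<lambda>t. KR d f\<^sub>\<rho> f\<^sub>\<pi> k (x(k := t))) differentiable (at (x k) within {-1..1})) \<and>
        (\<exists>R. holomorphic_extension k (KR_deriv d f\<^sub>\<rho> f\<^sub>\<pi> k) R
               (poly_nbhd k (\<lambda>j. C7 * \<delta> j) cinterval) \<and>
             (\<forall>z\<in>poly_nbhd k (\<lambda>j. C7 * \<delta> j) cinterval.
               R z \<in> nbhd C8 {1} \<and> Re (R z) \<ge> 1 / C8) \<and>
             (k \<ge> 2 \<longrightarrow>
               (\<forall>z\<in>PiE {1..k} (\<lambda>i. if i < k then nbhd (C7 * \<delta> i) cinterval else cinterval).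
                 R z \<in> nbhd (C8 / max 1 (\<delta> k)) {1})))))"
proof -
  define q where "q = M / L"
  have q: "0 < q" using assms by (simp add: q_def)
  show ?thesis
  \<comment> \<open>All three witnesses are fixed before \<open>d\<close> and
    \<open>\<delta>\<close> and involve only \<open>M\<close> and \<open>L\<close>.\<close>
  proof (rule exI[of _ "M * (M / L) ^ 6 / 512"], rule conjI, use assms in simp,
      rule exI[of _ "q\<^sup>2 / 64"], rule conjI, use q in simp,
      rule exI[of _ "200 / q ^ 4"], rule conjI, use q in simp, intro allI impI ballI)
    fix d \<delta> f\<^sub>\<rho> f\<^sub>\<pi> F\<^sub>\<rho> F\<^sub>\<pi> k
    assume \<delta>: "\<forall>j\<in>{1..d}. 0 < (\<delta> j :: real)"
      and adm: "admissible_density d \<delta> M L (M * (M / L) ^ 6 / 512) f\<^sub>\<rho> F\<^sub>\<rho>"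
        "admissible_density d \<delta> M L (M * (M / L) ^ 6 / 512) f\<^sub>\<pi> F\<^sub>\<pi>"
      and k: "k \<in> {1..d}"
    interpret transport d \<delta> M L f\<^sub>\<rho> f\<^sub>\<pi> F\<^sub>\<rho> F\<^sub>\<pi>
      by standard (use assms \<delta> adm in auto)
    have qq: "rho.q = q" by (simp add: rho.q_def q_def)
    have dom: "z \<in> poly_dom k \<zeta>" if "z \<in> poly_nbhd k \<zeta> cinterval" for z
      using that poly_nbhd_subset_dom by blast
    \<comment> \<open>The domain of (ii) keeps the last coordinate in the interval, hence inside its
      neighbourhood of radius \<open>\<zeta> k\<close>, so the same function \<open>R k\<close>
      serves (i) and (ii).\<close>
    have dom2: "z \<in> poly_dom k \<zeta>" "z k \<in> cinterval"
      if z: "z \<in> PiE {1..k} (\<lambda>i. if i < k then nbhd (\<zeta> i) cinterval else cinterval)" for z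
    proof -
      have "z k \<in> (if k < k then nbhd (\<zeta> k) cinterval else cinterval)"
        using PiE_mem[OF z, of k] k by simp
      then show zk: "z k \<in> cinterval" by simp
      show "z \<in> poly_dom k \<zeta>"
        unfolding poly_dom_def
      proof safe
        fix i assume i: "i \<in> {1..k}"
        show "z i \<in> nbhd (\<zeta> i) cinterval"
        proof (cases "i = k")
          case True
          obtain t where "z k = complex_of_real t" "t \<in> {-1..1}" using zk by (auto simp: cinterval_def)
          then show ?thesis using True of_real_in_nbhd[OF _ \<zeta>_pos[OF k]] by simp
        next
          case False
          then show ?thesis using PiE_mem[OF z i] i by simp
        qed
      qed
    qed
    have C7: "q\<^sup>2 / 64 * \<delta> i = \<zeta> i" for i by (simp add: \<zeta>_def qq)
    show "(\<forall>x\<in>cube k. (\<lambda>t. KR d f\<^sub>\<rho> f\<^sub>\<pi> k (x(k := t))) differentiable (at (x k) within {-1..1})) \<and>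
        (\<exists>R. holomorphic_extension k (KR_deriv d f\<^sub>\<rho> f\<^sub>\<pi> k) R
               (poly_nbhd k (\<lambda>j. q\<^sup>2 / 64 * \<delta> j) cinterval) \<and>
             (\<forall>z\<in>poly_nbhd k (\<lambda>j. q\<^sup>2 / 64 * \<delta> j) cinterval.
               R z \<in> nbhd (200 / q ^ 4) {1} \<and> Re (R z) \<ge> 1 / (200 / q ^ 4)) \<and>
             (k \<ge> 2 \<longrightarrow>
               (\<forall>z\<in>PiE {1..k} (\<lambda>i. if i < k then nbhd (q\<^sup>2 / 64 * \<delta> i) cinterval else cinterval).
                 R z \<in> nbhd (200 / q ^ 4 / max 1 (\<delta> k)) {1})))"
      unfolding C7
    proof (intro conjI ballI exI[of _ "R k"] impI)
      fix z assume "z \<in> poly_nbhd k \<zeta> cinterval"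
      then have z: "z \<in> poly_dom k \<zeta>" by (rule dom)
      show "R k z \<in> nbhd (200 / q ^ 4) {1}" "1 / (200 / q ^ 4) \<le> Re (R k z)"
        using norm_R_minus_1_less[OF k z] Re_R_ge[OF k z] unfolding qq nbhd_def by auto
    next
      fix z assume z: "z \<in> PiE {1..k} (\<lambda>i. if i < k then nbhd (\<zeta> i) cinterval else cinterval)"
      show "R k z \<in> nbhd (200 / q ^ 4 / max 1 (\<delta> k)) {1}"
        using R_near_1_strict[OF k dom2[OF z]] unfolding qq nbhd_def by auto
    qed (use KR_differentiable[OF k] holomorphic_extension_R[OF k] in auto)
  qed
qed

end
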